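(* Let $\mathcal A\subset \mathcal D'(\mathbb R,X)$ be closed under addition. Then $\mathcal D'_{\mathcal D'_{\mathcal A}}(\mathbb R,X)=\mathcal D'_{\mathcal A}(\mathbb R,X)$.
   Context: $X$ is a Banach space over $\mathbb K=\mathbb R$ or $\mathbb C$. $\mathcal D(\mathbb R,\mathbb K)$ is the space of Schwartz test functions (infinitely differentiable, compact support), and $\mathcal D'(\mathbb R,X)$ is the set of linear continuous maps $T:\mathcal D(\mathbb R,\mathbb K)\to X$. Locally (Bochner) integrable functions $f:\mathbb R\to X$ are identified with the distributions $\varphi\mapsto\int \varphi f\,dt$. For $T\in\mathcal D'(\mathbb R,X)$ and $\varphi\in\mathcal D(\mathbb R,\mathbb K)$, $T*\varphi$ is the $C^\infty$ function $(T*\varphi)(x)=T(y\mapsto\varphi(x-y))$. For any $\mathcal B\subset\mathcal D'(\mathbb R,X)$ define $\mathcal D'_{\mathcal B}(\mathbb R,X)=\{T\in\mathcal D'(\mathbb R,X): T*\varphi\in\mathcal B \text{ for all }\varphi\in\mathcal D(\mathbb R,\mathbb K)\}$. $\mathcal D'_{\mathcal D'_{\mathcal A}}(\mathbb R,X)$ is this construction applied to $\mathcal B=\mathcal D'_{\mathcal A}(\mathbb R,X)$. *)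

theory Defs
  imports "HOL-Analysis.Analysis"
begin

text \<open>The scalar field is a type \<open>'k\<close> of sort \<open>{real_normed_field, euclidean_space}\<close>. Up to
  isometric isomorphism \<open>real\<close> and \<open>complex\<close> are the only such fields (Frobenius), and both types
  have this sort. A Banach space over \<open>'k\<close> is a (real) \<open>banach\<close> type together with a
  multiplication by scalars from \<open>'k\<close> that is homogeneous for the norm and extends \<open>(*\<^sub>R)\<close>.\<close>

locale banach_over = vector_space smul
  for smul :: "'k::{real_normed_field, euclidean_space} \<Rightarrow> 'x::banach \<Rightarrow> 'x" +
  assumes norm_smul: "norm (smul c x) = norm c * norm x"
    and smul_of_real: "smul (of_real r) x = r *\<^sub>R x"

lemma banach_over_real: "banach_over ((*\<^sub>R) :: real \<Rightarrow> 'x::banach \<Rightarrow> 'x)"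
  by unfold_locales (auto simp: algebra_simps)

lemma banach_over_complex: "banach_over ((*) :: complex \<Rightarrow> complex \<Rightarrow> complex)"
  by unfold_locales (auto simp: algebra_simps norm_mult scaleR_conv_of_real)


definition iter_deriv :: "nat \<Rightarrow> (real \<Rightarrow> 'a::real_normed_vector) \<Rightarrow> real \<Rightarrow> 'a" where
  "iter_deriv n f = ((\<lambda>g t. vector_derivative g (at t)) ^^ n) f"

definition smooth :: "(real \<Rightarrow> 'a::real_normed_vector) \<Rightarrow> bool" where
  "smooth f \<longleftrightarrow> (\<forall>n t. iter_deriv n f differentiable (at t))"

definition supp :: "(real \<Rightarrow> 'a::zero) \<Rightarrow> real set" where
  "supp f = closure {t. f t \<noteq> 0}"

definition test_functions :: "(real \<Rightarrow> 'k::{real_normed_field, euclidean_space}) set" where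
  "test_functions = {\<phi>. smooth \<phi> \<and> compact (supp \<phi>)}"

definition test_functions_in ::
    "real set \<Rightarrow> (real \<Rightarrow> 'k::{real_normed_field, euclidean_space}) set" where
  "test_functions_in K = {\<phi> \<in> test_functions. supp \<phi> \<subseteq> K}"

text \<open>The usual inductive limit topology on the space of test functions: the finest locally convex
  topology for which the inclusions of the Frechet spaces \<open>test_functions_in K\<close>, \<open>K\<close> compact, are
  continuous. A base of neighbourhoods of \<open>0\<close> is given by the absolutely convex sets whose
  trace on each \<open>test_functions_in K\<close> is a neighbourhood of \<open>0\<close> there, i.e. contains a ball of one
  of the seminorms \<open>\<phi> \<mapsto> max\<^sub>j\<^sub>\<le>\<^sub>N sup\<^sub>t norm (iter_deriv j \<phi> t)\<close>.\<close>

definition test_nhds0 :: "(real \<Rightarrow> 'k::{real_normed_field, euclidean_space}) set set" where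
  "test_nhds0 = {W. W \<subseteq> test_functions \<and>
     (\<forall>\<phi>\<in>W. \<forall>\<psi>\<in>W. \<forall>a b. norm a + norm b \<le> 1 \<longrightarrow> (\<lambda>t. a * \<phi> t + b * \<psi> t) \<in> W) \<and>
     (\<forall>K. compact K \<longrightarrow>
        (\<exists>N. \<exists>e>0. {\<phi> \<in> test_functions_in K. \<forall>j\<le>N. \<forall>t. norm (iter_deriv j \<phi> t) < e} \<subseteq> W))}"

definition test_topology :: "(real \<Rightarrow> 'k::{real_normed_field, euclidean_space}) topology" where
  "test_topology = topology (\<lambda>U. U \<subseteq> test_functions \<and>
     (\<forall>\<phi>\<in>U. \<exists>W\<in>test_nhds0. \<forall>w\<in>W. (\<lambda>t. \<phi> t + w t) \<in> U))"

lemma test_nhds0_Int: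
  assumes "V \<in> test_nhds0" "W \<in> test_nhds0"
  shows "V \<inter> W \<in> test_nhds0"
proof -
  have "\<exists>N. \<exists>e>0. {\<phi> \<in> test_functions_in K. \<forall>j\<le>N. \<forall>t. norm (iter_deriv j \<phi> t) < e} \<subseteq> V \<inter> W"
    if "compact K" for K
  proof -
    obtain N e where 1: "e > 0"
      "{\<phi> \<in> test_functions_in K. \<forall>j\<le>N. \<forall>t. norm (iter_deriv j \<phi> t) < e} \<subseteq> V"
      using assms(1) \<open>compact K\<close> unfolding test_nhds0_def by blast
    obtain M d where 2: "d > 0"
      "{\<phi> \<in> test_functions_in K. \<forall>j\<le>M. \<forall>t. norm (iter_deriv j \<phi> t) < d} \<subseteq> W"
      using assms(2) \<open>compact K\<close> unfolding test_nhds0_def by blast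
    show ?thesis
    proof (intro exI conjI)
      show "min d e > 0" using 1 2 by simp
      show "{\<phi> \<in> test_functions_in K. \<forall>j\<le>max M N. \<forall>t. norm (iter_deriv j \<phi> t) < min d e}
        \<subseteq> V \<inter> W"
        using 1 2 by (auto simp: le_max_iff_disj)
    qed
  qed
  then show ?thesis
    using assms unfolding test_nhds0_def by (simp add: le_infI1)
qed

lemma iter_deriv_lincomb:
  fixes \<phi> \<psi> :: "real \<Rightarrow> 'k::{real_normed_field, euclidean_space}"
  assumes "smooth \<phi>" "smooth \<psi>"
  shows "iter_deriv n (\<lambda>t. a * \<phi> t + b * \<psi> t) =
    (\<lambda>t. a * iter_deriv n \<phi> t + b * iter_deriv n \<psi> t)"
proof (induction n)
  case 0
  then show ?case by (simp add: iter_deriv_def)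
next
  case (Suc n)
  have *: "(iter_deriv n f has_vector_derivative iter_deriv (Suc n) f t) (at t)"
    if "smooth f" for f :: "real \<Rightarrow> 'k" and t
    using that vector_derivative_works unfolding smooth_def iter_deriv_def by fastforce
  show ?case
  proof
    fix t
    have "((\<lambda>t. a * iter_deriv n \<phi> t + b * iter_deriv n \<psi> t) has_vector_derivative
      a * iter_deriv (Suc n) \<phi> t + b * iter_deriv (Suc n) \<psi> t) (at t)"
      by (intro has_vector_derivative_add has_vector_derivative_mult_right * assms)
    then show "iter_deriv (Suc n) (\<lambda>t. a * \<phi> t + b * \<psi> t) t =
        a * iter_deriv (Suc n) \<phi> t + b * iter_deriv (Suc n) \<psi> t"
      using Suc by (simp add: iter_deriv_def vector_derivative_at)
  qed
qed

lemma test_functions_lincomb: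
  fixes \<phi> \<psi> :: "real \<Rightarrow> 'k::{real_normed_field, euclidean_space}"
  assumes "\<phi> \<in> test_functions" "\<psi> \<in> test_functions"
  shows "(\<lambda>t. a * \<phi> t + b * \<psi> t) \<in> test_functions"
proof -
  have s: "smooth \<phi>" "smooth \<psi>" and c: "compact (supp \<phi>)" "compact (supp \<psi>)"
    using assms by (auto simp: test_functions_def)
  have "smooth (\<lambda>t. a * \<phi> t + b * \<psi> t)"
    using s unfolding smooth_def iter_deriv_lincomb[OF s]
    by (intro allI differentiable_add differentiable_mult) auto
  moreover have "supp (\<lambda>t. a * \<phi> t + b * \<psi> t) \<subseteq> supp \<phi> \<union> supp \<psi>"
    unfolding supp_def closure_Un[symmetric] by (rule closure_mono) auto
  then have "compact (supp (\<lambda>t. a * \<phi> t + b * \<psi> t))"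
    using compact_Int_closed[OF compact_Un[OF c], of "supp (\<lambda>t. a * \<phi> t + b * \<psi> t)"]
    by (simp add: Int_absorb1 supp_def)
  ultimately show ?thesis by (simp add: test_functions_def)
qed

lemma openin_test_topology:
  fixes U :: "(real \<Rightarrow> 'k::{real_normed_field, euclidean_space}) set"
  shows "openin test_topology U \<longleftrightarrow> U \<subseteq> test_functions \<and>
     (\<forall>\<phi>\<in>U. \<exists>W\<in>test_nhds0. \<forall>w\<in>W. (\<lambda>t. \<phi> t + w t) \<in> U)"
proof -
  have "istopology (\<lambda>U :: (real \<Rightarrow> 'k) set. U \<subseteq> test_functions \<and>
     (\<forall>\<phi>\<in>U. \<exists>W\<in>test_nhds0. \<forall>w\<in>W. (\<lambda>t. \<phi> t + w t) \<in> U))"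
    unfolding istopology_def
  proof (intro conjI allI impI)
    fix S T :: "(real \<Rightarrow> 'k) set"
    assume S: "S \<subseteq> test_functions \<and> (\<forall>\<phi>\<in>S. \<exists>W\<in>test_nhds0. \<forall>w\<in>W. (\<lambda>t. \<phi> t + w t) \<in> S)"
      and T: "T \<subseteq> test_functions \<and> (\<forall>\<phi>\<in>T. \<exists>W\<in>test_nhds0. \<forall>w\<in>W. (\<lambda>t. \<phi> t + w t) \<in> T)"
    show "\<forall>\<phi>\<in>S \<inter> T. \<exists>W\<in>test_nhds0. \<forall>w\<in>W. (\<lambda>t. \<phi> t + w t) \<in> S \<inter> T"
    proof
      fix \<phi> assume "\<phi> \<in> S \<inter> T"
      then obtain V W where "V \<in> test_nhds0" "W \<in> test_nhds0"
        "\<forall>w\<in>V. (\<lambda>t. \<phi> t + w t) \<in> S" "\<forall>w\<in>W. (\<lambda>t. \<phi> t + w t) \<in> T"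
        using S T by blast
      then show "\<exists>W\<in>test_nhds0. \<forall>w\<in>W. (\<lambda>t. \<phi> t + w t) \<in> S \<inter> T"
        using test_nhds0_Int by (intro bexI[of _ "V \<inter> W"]) auto
    qed
  next
    fix \<K> :: "(real \<Rightarrow> 'k) set set"
    assume K: "\<forall>K\<in>\<K>. K \<subseteq> test_functions \<and>
      (\<forall>\<phi>\<in>K. \<exists>W\<in>test_nhds0. \<forall>w\<in>W. (\<lambda>t. \<phi> t + w t) \<in> K)"
    show "\<forall>\<phi>\<in>\<Union>\<K>. \<exists>W\<in>test_nhds0. \<forall>w\<in>W. (\<lambda>t. \<phi> t + w t) \<in> \<Union>\<K>"
    proof
      fix \<phi> assume "\<phi> \<in> \<Union>\<K>"
      then obtain K where "K \<in> \<K>" "\<phi> \<in> K" by auto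
      then obtain W where "W \<in> test_nhds0" "\<forall>w\<in>W. (\<lambda>t. \<phi> t + w t) \<in> K"
        using K by meson
      then show "\<exists>W\<in>test_nhds0. \<forall>w\<in>W. (\<lambda>t. \<phi> t + w t) \<in> \<Union>\<K>"
        using \<open>K \<in> \<K>\<close> by (intro bexI[of _ W]) auto
    qed
  qed (simp_all add: le_infI1 Union_least)
  then show ?thesis by (simp add: test_topology_def topology_inverse')
qed

lemma topspace_test_topology: "topspace test_topology = test_functions"
proof
  show "topspace test_topology \<subseteq> test_functions"
    using openin_test_topology openin_topspace by blast
  have "test_functions \<in> test_nhds0"
    by (auto simp: test_nhds0_def test_functions_lincomb test_functions_in_def intro: exI[of _ 1])
  then have "openin test_topology test_functions"
    unfolding openin_test_topology
    using test_functions_lincomb[where a = 1 and b = 1] by auto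
  then show "test_functions \<subseteq> topspace test_topology" by (rule openin_subset)
qed


text \<open>A distribution is a function defined on the set of test functions only; by the convention
  of \<open>extensional\<close> it is \<open>undefined\<close> elsewhere, so that \<open>(=)\<close> is equality of distributions.\<close>

definition distributions ::
    "('k::{real_normed_field, euclidean_space} \<Rightarrow> 'x::banach \<Rightarrow> 'x) \<Rightarrow> ((real \<Rightarrow> 'k) \<Rightarrow> 'x) set" where
  "distributions smul = {T \<in> extensional test_functions.
     (\<forall>\<phi>\<in>test_functions. \<forall>\<psi>\<in>test_functions. T (\<lambda>t. \<phi> t + \<psi> t) = T \<phi> + T \<psi>) \<and>
     (\<forall>c. \<forall>\<phi>\<in>test_functions. T (\<lambda>t. c * \<phi> t) = smul c (T \<phi>)) \<and>
     continuous_map test_topology euclidean T}"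

definition distribution_add ::
    "((real \<Rightarrow> 'k::{real_normed_field, euclidean_space}) \<Rightarrow> 'x::banach) \<Rightarrow> ((real \<Rightarrow> 'k) \<Rightarrow> 'x)
      \<Rightarrow> (real \<Rightarrow> 'k) \<Rightarrow> 'x" where
  "distribution_add S T = (\<lambda>\<phi>\<in>test_functions. S \<phi> + T \<phi>)"

text \<open>The distribution identified with a function \<open>f\<close>. It is only applied to smooth \<open>f\<close> below; then
  the integrand is continuous with compact support, and its gauge integral is its Bochner integral.
  The Bochner integral of the library cannot be used, as it requires a second countable
  (i.e. separable) space of values.\<close>

definition distribution_of ::
    "('k::{real_normed_field, euclidean_space} \<Rightarrow> 'x::banach \<Rightarrow> 'x) \<Rightarrow> (real \<Rightarrow> 'x)
      \<Rightarrow> (real \<Rightarrow> 'k) \<Rightarrow> 'x" where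
  "distribution_of smul f = (\<lambda>\<phi>\<in>test_functions. integral UNIV (\<lambda>t. smul (\<phi> t) (f t)))"

definition distribution_conv ::
    "((real \<Rightarrow> 'k::{real_normed_field, euclidean_space}) \<Rightarrow> 'x::banach) \<Rightarrow> (real \<Rightarrow> 'k)
      \<Rightarrow> real \<Rightarrow> 'x" where
  "distribution_conv T \<phi> = (\<lambda>x. T (\<lambda>y. \<phi> (x - y)))"

definition distributions_rel ::
    "('k::{real_normed_field, euclidean_space} \<Rightarrow> 'x::banach \<Rightarrow> 'x) \<Rightarrow> ((real \<Rightarrow> 'k) \<Rightarrow> 'x) set
      \<Rightarrow> ((real \<Rightarrow> 'k) \<Rightarrow> 'x) set" where
  "distributions_rel smul B = {T \<in> distributions smul.
     \<forall>\<phi>\<in>test_functions. distribution_of smul (distribution_conv T \<phi>) \<in> B}"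

end

theory Submission
  imports Defs
begin

text \<open>Two facts about convolution carry the theorem. The first is the identity
  \<open>(T * \<phi>) * \<psi> = T * (\<phi> * \<psi>)\<close> for a distribution \<open>T\<close> and test functions \<open>\<phi>\<close>, \<open>\<psi>\<close>
  (\<open>distribution_conv_conv\<close>). It says that \<open>T\<close> belongs to the twice iterated class exactly when
  \<open>T * (\<phi> * \<psi>)\<close> lies in \<open>A\<close> for all \<open>\<phi>\<close>, \<open>\<psi>\<close>, and since \<open>\<phi> * \<psi>\<close> is again a test function, this
  holds for every \<open>T\<close> of the simple class. The second is the theorem of Dixmier and Malliavin on the
  line (\<open>test_function_factorization\<close>): every test function is a sum of two convolutions of test
  functions. Hence \<open>T * \<phi>\<close> is a sum of two members of \<open>A\<close> if \<open>T\<close> is in the iterated class, and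
  closure under addition finishes the argument. The factorization cannot be avoided: for
  \<open>T = \<delta>\<close> and \<open>A\<close> the set of finite sums of functions \<open>\<phi> * \<psi>\<close>, the theorem asserts that every test
  function is such a sum.

  The factorization is obtained from truncated exponentials. For a cutoff \<open>\<theta>\<close> that is 1 near 0 and
  for \<open>l > 0\<close>, the kernel \<open>k(s) = l exp(-ls) \<theta>(s)\<close> on \<open>s \<ge> 0\<close> satisfies \<open>(1 + D/l) k = \<delta> - g\<close>, where
  \<open>g(s) = - exp(-ls) \<theta>'(s)\<close> is a test function that tends to 0 with all its derivatives as
  \<open>l \<rightarrow> \<infinity>\<close>. Take such kernels \<open>k\<^sub>0, k\<^sub>1, \<dots>\<close> with supports in \<open>[0, 2\<^sup>-\<^sup>n\<^sup>-\<^sup>1]\<close>, and a kernel \<open>K\<close> of class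
  \<open>C\<^sup>1\<close> with \<open>D\<^sup>3 K = \<delta> - g'\<close>, \<open>g'\<close> a test function. The infinite convolution
  \<open>F = K * k\<^sub>0 * k\<^sub>1 * \<dots>\<close> has compact support, and it is smooth because each factor contributes a
  derivative. If the parameters \<open>l\<^sub>n\<close> grow fast enough in terms of \<open>\<phi>\<close>, then
  \<open>\<Phi> = \<Prod> (1 + D/l\<^sub>n) \<phi>'''\<close> converges in the space of test functions, and
  \<open>\<Prod> (\<delta> - g\<^sub>n) = \<delta> - \<Gamma>\<close> with a test function \<open>\<Gamma>\<close>. Moving all the operators from \<open>\<Phi>\<close> to \<open>F\<close> gives
  \<open>F * \<Phi> = (\<delta> - \<Gamma>) * (\<delta> - g') * \<phi>\<close>, that is, \<open>\<phi> = F * \<Phi> + (g' + \<Gamma> - \<Gamma> * g') * \<phi>\<close>.\<close>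

section \<open>Smooth functions of a real variable\<close>

lemma iter_deriv_0 [simp]: "iter_deriv 0 f = f"
  by (simp add: iter_deriv_def)

lemma iter_deriv_Suc: "iter_deriv (Suc n) f t = vector_derivative (iter_deriv n f) (at t)"
  by (simp add: iter_deriv_def)

lemma iter_deriv_has_vector_derivative:
  assumes "smooth f"
  shows "(iter_deriv n f has_vector_derivative iter_deriv (Suc n) f t) (at t)"
  using assms vector_derivative_works unfolding smooth_def iter_deriv_Suc by blast

text \<open>A sequence in which each function is the derivative of its predecessor must be the sequence of
  iterated derivatives; exhibiting such a sequence is the standard way to prove smoothness here.\<close>

lemma derivative_tower:
  assumes "H 0 = f" and H: "\<And>n t. (H n has_vector_derivative H (Suc n) t) (at t)"
  shows "smooth f" and "iter_deriv n f = H n"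
proof -
  have eq: "iter_deriv n f = H n" for n
  proof (induction n)
    case (Suc n)
    then show ?case
      by (intro ext) (simp add: iter_deriv_Suc vector_derivative_at[OF H])
  qed (simp add: assms(1))
  then show "iter_deriv n f = H n" .
  show "smooth f"
    unfolding smooth_def eq using H differentiableI_vector by blast
qed

text \<open>Smoothness is the greatest property that passes from a function to a derivative of it, so it
  may be proved by coinduction.\<close>

lemma smooth_coinduct:
  assumes "f \<in> C"
    and step: "\<And>f. f \<in> C \<Longrightarrow> \<exists>f'\<in>C. \<forall>t. (f has_vector_derivative f' t) (at t)"
  shows "smooth f"
proof -
  obtain d where d: "\<And>f. f \<in> C \<Longrightarrow> d f \<in> C" "\<And>f t. f \<in> C \<Longrightarrow> (f has_vector_derivative d f t) (at t)"
    using step by metis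
  have "(d ^^ n) f \<in> C" for n
    by (induction n) (auto simp: assms(1) d(1))
  then show ?thesis
    by (intro derivative_tower(1)[where H = "\<lambda>n. (d ^^ n) f"]) (auto intro: d(2))
qed

lemma smooth_iter_deriv: "smooth f \<Longrightarrow> smooth (iter_deriv k f)"
  by (rule derivative_tower(1)[where H = "\<lambda>n. iter_deriv (k + n) f"])
    (auto intro: iter_deriv_has_vector_derivative)

lemma iter_deriv_iter_deriv:
  assumes "smooth f"
  shows "iter_deriv n (iter_deriv k f) = iter_deriv (k + n) f"
  by (rule derivative_tower(2)[where H = "\<lambda>n. iter_deriv (k + n) f"])
    (auto intro: iter_deriv_has_vector_derivative assms)

lemma smooth_from_derivative:
  assumes "\<And>t. (f has_vector_derivative f' t) (at t)" "smooth f'"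
  shows "smooth f"
  by (rule derivative_tower(1)[where H = "\<lambda>n. case n of 0 \<Rightarrow> f | Suc n \<Rightarrow> iter_deriv n f'"])
    (auto split: nat.split intro: assms iter_deriv_has_vector_derivative)

lemma iter_deriv_1:
  assumes "\<And>t. (f has_vector_derivative f' t) (at t)"
  shows "iter_deriv (Suc 0) f = f'"
  by (intro ext) (simp add: iter_deriv_Suc vector_derivative_at[OF assms])

lemma smooth_continuous_on: "smooth f \<Longrightarrow> continuous_on S f"
  by (metis iter_deriv_0 iter_deriv_has_vector_derivative continuous_at_imp_continuous_on
      has_vector_derivative_continuous)

lemma smooth_iter_deriv_continuous_on: "smooth f \<Longrightarrow> continuous_on S (iter_deriv n f)"
  by (simp add: smooth_continuous_on smooth_iter_deriv)

lemma smooth_const: "smooth (\<lambda>t. c)"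
  by (rule smooth_coinduct[where C = "range (\<lambda>c t. c)"])
    (auto intro!: exI[of _ 0] has_vector_derivative_const)

lemma smooth_lincomb:
  fixes f g :: "real \<Rightarrow> 'k::{real_normed_field, euclidean_space}"
  assumes "smooth f" "smooth g"
  shows "smooth (\<lambda>t. a * f t + b * g t)"
  using assms unfolding smooth_def iter_deriv_lincomb[OF assms]
  by (intro allI differentiable_add differentiable_mult) auto

text \<open>Usually a derivative is not itself one of the functions under study but a linear combination of
  several of them; linear closures make coinduction applicable in this situation.\<close>

inductive_set linear_closure :: "(real \<Rightarrow> 'a::real_normed_vector) set \<Rightarrow> (real \<Rightarrow> 'a) set"
  for B where
  generator: "f \<in> B \<Longrightarrow> f \<in> linear_closure B"
| combination: "f \<in> linear_closure B \<Longrightarrow> g \<in> linear_closure B \<Longrightarrow>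
    (\<lambda>t. a *\<^sub>R f t + b *\<^sub>R g t) \<in> linear_closure B"

lemma smooth_generators:
  assumes "f \<in> B"
    and step: "\<And>f. f \<in> B \<Longrightarrow> \<exists>f'\<in>linear_closure B. \<forall>t. (f has_vector_derivative f' t) (at t)"
  shows "smooth f"
proof (rule smooth_coinduct[where C = "linear_closure B"])
  show "f \<in> linear_closure B"
    using assms(1) by (rule linear_closure.generator)
next
  fix h assume "h \<in> linear_closure B"
  then show "\<exists>h'\<in>linear_closure B. \<forall>t. (h has_vector_derivative h' t) (at t)"
  proof induction
    case (combination f g a b)
    then obtain f' g' where "f' \<in> linear_closure B" "g' \<in> linear_closure B"
      and *: "\<And>t. (f has_vector_derivative f' t) (at t)" "\<And>t. (g has_vector_derivative g' t) (at t)"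
      by blast
    moreover have "((\<lambda>t. a *\<^sub>R f t + b *\<^sub>R g t) has_vector_derivative a *\<^sub>R f' t + b *\<^sub>R g' t) (at t)" for t
      using has_vector_derivative_add has_vector_derivative_scaleR[OF DERIV_const *(1), of a]
        has_vector_derivative_scaleR[OF DERIV_const *(2), of b]
      by fastforce
    ultimately show ?case
      by (intro bexI[of _ "\<lambda>t. a *\<^sub>R f' t + b *\<^sub>R g' t"] allI linear_closure.combination)
  qed (rule step)
qed

lemma smooth_mult:
  fixes f g :: "real \<Rightarrow> 'k::real_normed_field"
  assumes "smooth f" "smooth g"
  shows "smooth (\<lambda>t. f t * g t)"
proof -
  define B where "B = {h. \<exists>f g :: real \<Rightarrow> 'k. h = (\<lambda>t. f t * g t) \<and> smooth f \<and> smooth g}"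
  have B: "(\<lambda>t. f t * g t) \<in> B" if "smooth f" "smooth g" for f g :: "real \<Rightarrow> 'k"
    unfolding B_def using that by (intro CollectI exI[of _ f] exI[of _ g]) simp
  show ?thesis
  proof (rule smooth_generators[OF B[OF assms]])
    fix h assume "h \<in> B"
    then obtain f g where h: "h = (\<lambda>t. f t * g t)" and fg: "smooth f" "smooth g"
      unfolding B_def by blast
    have "(\<lambda>t. 1 *\<^sub>R (f t * iter_deriv 1 g t) + 1 *\<^sub>R (iter_deriv 1 f t * g t)) \<in> linear_closure B"
      by (intro linear_closure.intros B fg smooth_iter_deriv)
    moreover have "(h has_vector_derivative
        1 *\<^sub>R (f t * iter_deriv 1 g t) + 1 *\<^sub>R (iter_deriv 1 f t * g t)) (at t)" for t
      using has_vector_derivative_mult[OF iter_deriv_has_vector_derivative[OF fg(1), of 0]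
          iter_deriv_has_vector_derivative[OF fg(2), of 0]] by (simp add: h)
    ultimately show "\<exists>h'\<in>linear_closure B. \<forall>t. (h has_vector_derivative h' t) (at t)"
      by (intro bexI allI)
  qed
qed

lemma iter_deriv_cong_open:
  assumes "smooth g" "open S" "\<And>t. t \<in> S \<Longrightarrow> f t = g t" "t \<in> S"
  shows "iter_deriv n f t = iter_deriv n g t"
  using assms(4)
proof (induction n arbitrary: t)
  case (Suc n)
  have "(iter_deriv n f has_vector_derivative iter_deriv (Suc n) g t) (at t)"
    by (rule has_vector_derivative_transform_within_open[OF iter_deriv_has_vector_derivative[OF assms(1)]
          assms(2) Suc.prems]) (simp add: Suc.IH)
  then show ?case
    by (simp only: iter_deriv_Suc[of n f] vector_derivative_at)
qed (simp add: assms(3))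

lemma smooth_affine:
  assumes "smooth f"
  shows "smooth (\<lambda>t. f (a * t + b))"
    and "iter_deriv n (\<lambda>t. f (a * t + b)) = (\<lambda>t. a ^ n *\<^sub>R iter_deriv n f (a * t + b))"
proof -
  have H: "((\<lambda>t. a ^ n *\<^sub>R iter_deriv n f (a * t + b)) has_vector_derivative
      a ^ Suc n *\<^sub>R iter_deriv (Suc n) f (a * t + b)) (at t)" for n t
  proof -
    have "((\<lambda>t. a * t + b) has_vector_derivative a) (at t)"
      by (auto intro!: derivative_eq_intros)
    from vector_diff_chain_at[OF this iter_deriv_has_vector_derivative[OF assms, of n]]
    have "((\<lambda>t. iter_deriv n f (a * t + b)) has_vector_derivative
        a *\<^sub>R iter_deriv (Suc n) f (a * t + b)) (at t)"
      by (simp add: o_def)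
    from has_vector_derivative_scaleR[OF DERIV_const[of "a ^ n"] this]
    show ?thesis by (simp add: mult.commute)
  qed
  show "smooth (\<lambda>t. f (a * t + b))"
    by (rule derivative_tower(1)[where H = "\<lambda>n t. a ^ n *\<^sub>R iter_deriv n f (a * t + b)"]) (use H in auto)
  show "iter_deriv n (\<lambda>t. f (a * t + b)) = (\<lambda>t. a ^ n *\<^sub>R iter_deriv n f (a * t + b))"
    by (rule derivative_tower(2)[where H = "\<lambda>n t. a ^ n *\<^sub>R iter_deriv n f (a * t + b)"]) (use H in auto)
qed

lemma smooth_reflect: "smooth f \<Longrightarrow> smooth (\<lambda>t. f (b - t))"
  and iter_deriv_reflect:
    "smooth f \<Longrightarrow> iter_deriv n (\<lambda>t. f (b - t)) = (\<lambda>t. (-1) ^ n *\<^sub>R iter_deriv n f (b - t))"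
  using smooth_affine[where f = f and a = "-1" and b = b] by simp_all

lemma smooth_of_real:
  assumes "smooth f"
  shows "smooth (\<lambda>t. of_real (f t) :: 'k::real_normed_field)"
  by (rule derivative_tower(1)[where H = "\<lambda>n t. of_real (iter_deriv n f t)"])
    (auto intro!: has_vector_derivative_of_real iter_deriv_has_vector_derivative[OF assms]
      simp: has_real_derivative_iff_has_vector_derivative)

lemma smooth_exp: "smooth (\<lambda>t. exp (a * t) :: real)"
  by (rule derivative_tower(1)[where H = "\<lambda>n t. a ^ n * exp (a * t)"])
    (auto intro!: derivative_eq_intros simp flip: has_real_derivative_iff_has_vector_derivative)

lemma uniform_limit_geometric:
  fixes f :: "nat \<Rightarrow> real \<Rightarrow> 'a::banach"
  assumes inc: "\<And>n t. N \<le> n \<Longrightarrow> norm (f (Suc n) t - f n t) \<le> C * (1/2) ^ n"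
  shows "\<exists>g. uniform_limit UNIV f g sequentially"
proof -
  have "\<forall>\<^sub>F n in sequentially. \<forall>t\<in>UNIV. norm (f (Suc n) t - f n t) \<le> C * (1/2) ^ n"
    using eventually_ge_at_top[of N] by eventually_elim (auto intro: inc)
  moreover have "summable (\<lambda>n. C * (1/2) ^ n)"
    by (intro summable_mult summable_geometric) simp
  ultimately have "uniformly_convergent_on UNIV (\<lambda>n t. \<Sum>i<n. f (Suc i) t - f i t)"
    by (rule Weierstrass_m_test'_ev)
  then obtain h where h: "uniform_limit UNIV (\<lambda>n t. \<Sum>i<n. f (Suc i) t - f i t) h sequentially"
    by (auto simp: uniformly_convergent_on_def)
  have "uniform_limit UNIV (\<lambda>n t. (\<Sum>i<n. f (Suc i) t - f i t) + f 0 t) (\<lambda>t. h t + f 0 t) sequentially"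
    by (intro uniform_limit_intros h)
  moreover have "(\<Sum>i<n. f (Suc i) t - f i t) + f 0 t = f n t" for n t
    by (subst sum_lessThan_telescope) simp
  ultimately show ?thesis by auto
qed

lemma norm_diff_le_geometric:
  fixes f :: "nat \<Rightarrow> 'a::real_normed_vector"
  assumes "\<And>n. norm (f (Suc n) - f n) \<le> C * (1/2) ^ n"
  shows "norm (f n - f 0) \<le> 2 * C"
proof -
  have "norm (f n - f 0) \<le> 2 * C * (1 - (1/2) ^ n)"
  proof (induction n)
    case (Suc n)
    then show ?case
      using norm_triangle_ineq[of "f (Suc n) - f n" "f n - f 0"] assms[of n] by (simp add: algebra_simps)
  qed simp
  also have "\<dots> \<le> 2 * C"
    using order_trans[OF norm_ge_zero assms[of 0]] by (simp add: mult_left_le)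
  finally show ?thesis .
qed

text \<open>The derivatives of each fixed order converge uniformly, because only finitely many of their
  increments escape the geometric bound; hence the limits of the derivatives of successive orders
  are derivatives of each other.\<close>

lemma smooth_uniform_limit:
  fixes f :: "nat \<Rightarrow> real \<Rightarrow> 'a::banach"
  assumes f: "\<And>n. smooth (f n)"
    and inc: "\<And>n k t. k \<le> n \<Longrightarrow> norm (iter_deriv k (f (Suc n)) t - iter_deriv k (f n) t) \<le> C * (1/2) ^ n"
  obtains g where "smooth g" "uniform_limit UNIV f g sequentially"
proof -
  have "\<exists>g. uniform_limit UNIV (\<lambda>n. iter_deriv k (f n)) g sequentially" for k
    using uniform_limit_geometric[of k "\<lambda>n. iter_deriv k (f n)"] inc by blast
  then obtain H where H: "\<And>k. uniform_limit UNIV (\<lambda>n. iter_deriv k (f n)) (H k) sequentially"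
    by metis
  have "(H k has_vector_derivative H (Suc k) t) (at t)" for k t
  proof -
    have lim: "(\<lambda>n. iter_deriv j (f n) x) \<longlonglongrightarrow> H j x" for j x
      using tendsto_uniform_limitI[OF H] by simp
    have "\<exists>g. \<forall>x\<in>UNIV. (\<lambda>n. iter_deriv k (f n) x) \<longlonglongrightarrow> g x \<and>
        (g has_derivative (\<lambda>h. h *\<^sub>R H (Suc k) x)) (at x within UNIV)"
    proof (rule has_derivative_sequence)
      show "(iter_deriv k (f n) has_derivative (\<lambda>h. h *\<^sub>R iter_deriv (Suc k) (f n) x)) (at x within UNIV)" for n x
        using iter_deriv_has_vector_derivative[OF f] by (simp add: has_vector_derivative_def)
      show "\<forall>\<^sub>F n in sequentially. \<forall>x\<in>UNIV. \<forall>h. norm (h *\<^sub>R iter_deriv (Suc k) (f n) x - h *\<^sub>R H (Suc k) x)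
          \<le> e * norm h" if "e > 0" for e
        using uniform_limitD[OF H[of "Suc k"] that]
      proof eventually_elim
        case (elim n)
        then show ?case
          by (auto simp: dist_norm less_imp_le mult.commute[of e] simp flip: scaleR_diff_right intro!: mult_left_mono)
      qed
    qed (use lim in auto)
    then obtain g where g: "\<And>x. (\<lambda>n. iter_deriv k (f n) x) \<longlonglongrightarrow> g x"
      "\<And>x. (g has_vector_derivative H (Suc k) x) (at x)"
      by (auto simp: has_vector_derivative_def)
    have "g = H k"
      using LIMSEQ_unique[OF g(1) lim] by auto
    with g(2) show ?thesis by simp
  qed
  then have "smooth (H 0)"
    by (rule derivative_tower(1)[OF refl])
  moreover have "uniform_limit UNIV f (H 0) sequentially"
    using H[of 0] by simp
  ultimately show ?thesis by (rule that)
qed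

section \<open>Test functions\<close>

lemma zero_outside_supp: "t \<notin> supp f \<Longrightarrow> f t = 0"
  using closure_subset[of "{t. f t \<noteq> 0}"] by (auto simp: supp_def)

lemma supp_subset_atLeastAtMost: "(\<And>t. t \<notin> {a..b} \<Longrightarrow> f t = 0) \<Longrightarrow> supp f \<subseteq> {a..b}"
  unfolding supp_def by (rule closure_minimal) (blast, rule closed_atLeastAtMost)

lemma test_functionI:
  assumes "smooth f" "\<And>t. t \<notin> {a..b} \<Longrightarrow> f t = 0"
  shows "f \<in> test_functions"
proof -
  have "compact (supp f)"
    using supp_subset_atLeastAtMost[of a b f] assms(2) compact_Int_closed[OF compact_Icc[of a b], of "supp f"]
    by (simp add: Int_absorb1 supp_def)
  then show ?thesis by (simp add: test_functions_def assms(1))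
qed

lemma test_function_smooth: "f \<in> test_functions \<Longrightarrow> smooth f"
  by (simp add: test_functions_def)

lemma test_function_supportE:
  assumes "f \<in> test_functions"
  obtains R where "R > 0" "\<And>t. t \<notin> {-R..R} \<Longrightarrow> f t = 0"
proof -
  obtain R where "R > 0" "\<And>t. t \<in> supp f \<Longrightarrow> norm t \<le> R"
    using assms compact_imp_bounded[of "supp f"] by (auto simp: test_functions_def bounded_pos)
  then show ?thesis
    using zero_outside_supp[of _ f] by (intro that[of R]) fastforce+
qed

lemma iter_deriv_zero: "iter_deriv n (\<lambda>t. 0) = (\<lambda>t. 0)"
  by (rule derivative_tower(2)[where H = "\<lambda>n t. 0"]) auto

lemma iter_deriv_zero_outside:
  assumes "\<And>t. t \<notin> {a..b} \<Longrightarrow> f t = 0" "t \<notin> {a..b}"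
  shows "iter_deriv n f t = 0"
  using iter_deriv_cong_open[OF smooth_const[of 0], of "- {a..b}" f t n] assms
  by (simp add: iter_deriv_zero open_Compl)

lemma bounded_of_compact_support:
  fixes f :: "real \<Rightarrow> 'a::real_normed_vector"
  assumes "continuous_on {a..b} f" "\<And>t. t \<notin> {a..b} \<Longrightarrow> f t = 0"
  obtains M where "M > 0" "\<And>t. norm (f t) \<le> M"
proof -
  have "bounded (f ` {a..b})"
    by (intro compact_imp_bounded compact_continuous_image assms(1)) auto
  then obtain M where M: "M > 0" "\<And>t. t \<in> {a..b} \<Longrightarrow> norm (f t) \<le> M"
    unfolding bounded_pos by blast
  have "norm (f t) \<le> M" for t
    using M assms(2)[of t] by (cases "t \<in> {a..b}") auto
  with M(1) that show ?thesis by blast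
qed

lemma test_function_derivs_bounded:
  assumes "f \<in> test_functions"
  obtains M where "M > 0" "\<And>j t. j \<le> n \<Longrightarrow> norm (iter_deriv j f t) \<le> M"
proof -
  obtain R where R: "\<And>t. t \<notin> {-R..R} \<Longrightarrow> f t = 0"
    using test_function_supportE[OF assms] by metis
  have "\<exists>M. M > 0 \<and> (\<forall>t. norm (iter_deriv j f t) \<le> M)" for j
  proof -
    have "continuous_on {-R..R} (iter_deriv j f)"
      by (rule smooth_iter_deriv_continuous_on[OF test_function_smooth[OF assms]])
    moreover have "\<And>t. t \<notin> {-R..R} \<Longrightarrow> iter_deriv j f t = 0"
      by (rule iter_deriv_zero_outside[OF R])
    ultimately show ?thesis
      by (rule bounded_of_compact_support) auto
  qed
  then obtain M where M: "\<And>j. M j > 0" "\<And>j t. norm (iter_deriv j f t) \<le> M j"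
    by metis
  have "norm (iter_deriv j f t) \<le> (\<Sum>j\<le>n. M j)" if "j \<le> n" for j t
    using M(2)[of j t] member_le_sum[of j "{..n}" M] that M(1) by (force simp: less_imp_le)
  moreover have "(\<Sum>j\<le>n. M j) > 0"
    by (intro sum_pos) (auto simp: M)
  ultimately show ?thesis using that by blast
qed

section \<open>Convolution\<close>

text \<open>The Bochner integral over the whole line is used because commutativity then holds for arbitrary
  functions, by an affine change of variables.\<close>

definition convolution ::
    "(real \<Rightarrow> 'k::{real_normed_field, euclidean_space}) \<Rightarrow> (real \<Rightarrow> 'k) \<Rightarrow> real \<Rightarrow> 'k"
    (infixl "\<star>" 70) where
  "f \<star> g = (\<lambda>t. \<integral>s. f s * g (t - s) \<partial>lborel)"

text \<open>A kernel may jump at the end points of its interval. This covers the truncated exponentials,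
  which jump at 0; convolving such a kernel with a continuous function is still harmless, because
  the convolution is an integral of a continuous function over the interval.\<close>

definition kernel_on :: "real \<Rightarrow> real \<Rightarrow> (real \<Rightarrow> 'a::real_normed_vector) \<Rightarrow> bool" where
  "kernel_on a b u \<longleftrightarrow> continuous_on {a..b} u \<and> (\<forall>s. s \<notin> {a..b} \<longrightarrow> u s = 0)"

lemma kernel_on_integrable:
  fixes u :: "real \<Rightarrow> 'a::euclidean_space"
  assumes "kernel_on a b u"
  shows "integrable lborel u"
proof -
  have "integrable lborel (\<lambda>s. indicator {a..b} s *\<^sub>R u s)"
    using assms by (intro borel_integrable_compact) (auto simp: kernel_on_def)
  also have "(\<lambda>s. indicator {a..b} s *\<^sub>R u s) = u"
    using assms by (auto simp: kernel_on_def indicator_def)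
  finally show ?thesis .
qed

lemma kernel_on_integral:
  fixes u :: "real \<Rightarrow> 'a::euclidean_space"
  assumes "kernel_on a b u"
  shows "(\<integral>s. u s \<partial>lborel) = integral {a..b} u"
proof -
  have "(\<integral>s. u s \<partial>lborel) = integral UNIV u"
    by (rule integral_lborel[symmetric, OF kernel_on_integrable[OF assms]])
  also have "\<dots> = integral UNIV (\<lambda>s. if s \<in> {a..b} then u s else 0)"
    using assms by (intro integral_cong) (auto simp: kernel_on_def)
  also have "\<dots> = integral {a..b} u"
    by (rule integral_restrict_UNIV)
  finally show ?thesis .
qed

lemma kernel_on_times:
  fixes u g :: "real \<Rightarrow> 'a::real_normed_algebra"
  assumes "kernel_on a b u" "continuous_on UNIV g"
  shows "kernel_on a b (\<lambda>s. u s * g (t - s))"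
  using assms unfolding kernel_on_def
  by (auto intro!: continuous_intros continuous_on_compose2[OF assms(2)])

lemma convolution_eq_integral:
  assumes "kernel_on a b u" "continuous_on UNIV g"
  shows "(u \<star> g) t = integral {a..b} (\<lambda>s. u s * g (t - s))"
  unfolding convolution_def by (rule kernel_on_integral[OF kernel_on_times[OF assms]])

lemma convolution_integrable:
  fixes u g :: "real \<Rightarrow> 'k::{real_normed_field, euclidean_space}"
  assumes "kernel_on a b u" "continuous_on UNIV g"
  shows "integrable lborel (\<lambda>s. u s * g (t - s))"
  by (rule kernel_on_integrable[OF kernel_on_times[OF assms]])

lemma convolution_commute: "f \<star> g = g \<star> f"
proof
  fix t
  have "(f \<star> g) t = (\<integral>s. f (t + (-1) * s) * g (t - (t + (-1) * s)) \<partial>lborel)"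
    unfolding convolution_def
    by (subst lborel_integral_real_affine[where c = "-1" and t = t]) auto
  also have "\<dots> = (g \<star> f) t"
    unfolding convolution_def by (simp add: mult.commute)
  finally show "(f \<star> g) t = (g \<star> f) t" .
qed

lemma convolution_add_right:
  assumes "kernel_on a b u" "continuous_on UNIV f" "continuous_on UNIV g"
  shows "u \<star> (\<lambda>t. f t + g t) = (\<lambda>t. (u \<star> f) t + (u \<star> g) t)"
  using convolution_integrable[OF assms(1,2)] convolution_integrable[OF assms(1,3)]
  by (intro ext) (simp add: convolution_def distrib_left)

lemma convolution_diff_right:
  assumes "kernel_on a b u" "continuous_on UNIV f" "continuous_on UNIV g"
  shows "u \<star> (\<lambda>t. f t - g t) = (\<lambda>t. (u \<star> f) t - (u \<star> g) t)"
  using convolution_integrable[OF assms(1,2)] convolution_integrable[OF assms(1,3)]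
  by (intro ext) (simp add: convolution_def right_diff_distrib)

lemma convolution_scaleR_right: "u \<star> (\<lambda>t. c *\<^sub>R f t) = (\<lambda>t. c *\<^sub>R (u \<star> f) t)"
  by (intro ext) (simp add: convolution_def)

lemma convolution_continuous:
  assumes "kernel_on a b u" "continuous_on UNIV g"
  shows "continuous_on UNIV (u \<star> g)"
proof -
  have "continuous_on UNIV (\<lambda>t. integral (cbox a b) (\<lambda>s. u s * g (t - s)))"
    using assms unfolding kernel_on_def
    by (intro integral_continuous_on_param)
      (auto simp: split_beta intro!: continuous_intros continuous_on_compose2[OF assms(2)]
        continuous_on_compose2[of "{a..b}" u])
  then show ?thesis
    by (simp add: convolution_eq_integral[OF assms] cong: continuous_on_cong)
qed

lemma convolution_zero_outside:
  assumes "\<And>s. s \<notin> {a..b} \<Longrightarrow> u s = 0" "\<And>s. s \<notin> {c..d} \<Longrightarrow> g s = 0"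
    and "t \<notin> {a + c..b + d}"
  shows "(u \<star> g) t = 0"
proof -
  have "(\<lambda>s. u s * g (t - s)) = (\<lambda>s. 0)"
  proof
    fix s show "u s * g (t - s) = 0"
  proof (cases "s \<in> {a..b}")
    case True
    then have "t - s \<notin> {c..d}" using assms(3) by auto
    then show ?thesis by (simp add: assms(2))
    qed (simp add: assms(1))
  qed
  then show ?thesis by (simp add: convolution_def)
qed

lemma convolution_kernel_on:
  assumes "kernel_on a b u" "continuous_on UNIV g" "\<And>s. s \<notin> {c..d} \<Longrightarrow> g s = 0"
  shows "kernel_on (a + c) (b + d) (u \<star> g)"
  using convolution_continuous[OF assms(1,2)] convolution_zero_outside[of a b u c d g] assms(1,3)
  unfolding kernel_on_def using continuous_on_subset by blast

lemma norm_convolution_le: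
  assumes u: "kernel_on a b u" and g: "continuous_on UNIV g"
    and w: "\<And>s. norm (u s) \<le> w s" "integrable lborel w" "(\<integral>s. w s \<partial>lborel) \<le> M"
    and B: "\<And>s. norm (g s) \<le> B"
  shows "norm ((u \<star> g) t) \<le> M * B"
proof -
  have "B \<ge> 0" using B[of 0] norm_ge_zero order_trans by blast
  have "norm ((u \<star> g) t) \<le> (\<integral>s. norm (u s * g (t - s)) \<partial>lborel)"
    unfolding convolution_def by (rule integral_norm_bound)
  also have "\<dots> \<le> (\<integral>s. w s * B \<partial>lborel)"
    using w(1,2) B order_trans[OF norm_ge_zero w(1)]
    by (intro integral_mono integrable_norm convolution_integrable[OF u g])
      (auto simp: norm_mult intro!: mult_mono)
  also have "\<dots> \<le> M * B"
    using w(3) \<open>B \<ge> 0\<close> by (simp add: mult_right_mono)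
  finally show ?thesis .
qed

lemma norm_convolution_le_sup:
  assumes u: "kernel_on a b u" and g: "continuous_on UNIV g" and "a \<le> b"
    and A: "\<And>s. norm (u s) \<le> A" and B: "\<And>s. norm (g s) \<le> B"
  shows "norm ((u \<star> g) t) \<le> (b - a) * A * B"
proof (rule norm_convolution_le[OF u g, where w = "\<lambda>s. A * indicator {a..b} s"])
  show "norm (u s) \<le> A * indicator {a..b} s" for s
    using A[of s] u by (cases "s \<in> {a..b}") (auto simp: kernel_on_def)
qed (use \<open>a \<le> b\<close> B in auto)

lemma convolution_has_vector_derivative:
  assumes u: "kernel_on a b u"
    and g: "\<And>t. (g has_vector_derivative g' t) (at t)" and g': "continuous_on UNIV g'"
  shows "((u \<star> g) has_vector_derivative (u \<star> g') t) (at t)"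
proof -
  have cont: "continuous_on UNIV g"
    using g by (meson continuous_at_imp_continuous_on has_vector_derivative_continuous)
  have "((\<lambda>t. integral (cbox a b) (\<lambda>s. u s * g (t - s))) has_vector_derivative
      integral (cbox a b) (\<lambda>s. u s * g' (t - s))) (at t within UNIV)"
  proof (rule leibniz_rule_vector_derivative[where U = UNIV])
    fix x s
    have "((\<lambda>x. x - s) has_vector_derivative 1) (at x)"
      by (auto intro!: derivative_eq_intros)
    from vector_diff_chain_at[OF this g[of "x - s"]]
    have "((\<lambda>x. g (x - s)) has_vector_derivative g' (x - s)) (at x)"
      by (simp add: o_def)
    then show "((\<lambda>x. u s * g (x - s)) has_vector_derivative u s * g' (x - s)) (at x within UNIV)"
      by (simp add: has_vector_derivative_mult_right)
  next
    show "(\<lambda>s. u s * g (x - s)) integrable_on cbox a b" for x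
      using kernel_on_times[OF u cont, of x] by (auto simp: kernel_on_def intro: integrable_continuous_real)
  next
    show "continuous_on (UNIV \<times> cbox a b) (\<lambda>(x, t). u t * g' (x - t))"
      using u unfolding kernel_on_def
      by (auto simp: split_beta intro!: continuous_intros continuous_on_compose2[OF g']
        continuous_on_compose2[of "{a..b}" u])
  qed auto
  then show ?thesis
    by (simp add: convolution_eq_integral[OF u cont, abs_def] convolution_eq_integral[OF u g'])
qed

lemma smooth_convolution:
  assumes "kernel_on a b u" "smooth g"
  shows "smooth (u \<star> g)" and "iter_deriv n (u \<star> g) = u \<star> iter_deriv n g"
proof -
  have H: "((u \<star> iter_deriv n g) has_vector_derivative (u \<star> iter_deriv (Suc n) g) t) (at t)" for n t
    by (intro convolution_has_vector_derivative[OF assms(1)] iter_deriv_has_vector_derivative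
        smooth_iter_deriv_continuous_on assms(2))
  show "smooth (u \<star> g)"
    by (rule derivative_tower(1)[where H = "\<lambda>n. u \<star> iter_deriv n g"]) (use H in auto)
  show "iter_deriv n (u \<star> g) = u \<star> iter_deriv n g"
    by (rule derivative_tower(2)[where H = "\<lambda>n. u \<star> iter_deriv n g"]) (use H in auto)
qed

text \<open>Fubini's theorem. Together with commutativity this gives associativity, in the form that is
  useful for interchanging two kernels.\<close>

lemma convolution_left_commute:
  assumes u: "kernel_on a b u" and v: "kernel_on c d v" and g: "continuous_on UNIV g"
  shows "u \<star> (v \<star> g) = v \<star> (u \<star> g)"
proof
  fix t
  define h where "h = (\<lambda>r s. u s * (v r * g (t - s - r)))"
  have "integrable (lborel :: (real \<times> real) measure)
      (\<lambda>p. indicator ({c..d} \<times> {a..b}) p *\<^sub>R case_prod h p)"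
    using u v unfolding kernel_on_def h_def
    by (intro borel_integrable_compact compact_Times)
      (auto simp: split_beta intro!: continuous_intros continuous_on_compose2[OF g]
        continuous_on_compose2[of "{a..b}" u] continuous_on_compose2[of "{c..d}" v])
  also have "(\<lambda>p. indicator ({c..d} \<times> {a..b}) p *\<^sub>R case_prod h p) = case_prod h"
    using u v by (auto simp: h_def kernel_on_def indicator_def fun_eq_iff)
  finally have "integrable (lborel \<Otimes>\<^sub>M lborel) (case_prod h)"
    by (simp add: lborel_prod)
  from lborel_pair.Fubini_integral[OF this]
  have "(\<integral>s. (\<integral>r. h r s \<partial>lborel) \<partial>lborel) = (\<integral>r. (\<integral>s. h r s \<partial>lborel) \<partial>lborel)" .
  moreover have "(\<integral>r. h r s \<partial>lborel) = u s * (v \<star> g) (t - s)" for s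
    unfolding h_def convolution_def by simp
  moreover have "(\<integral>s. h r s \<partial>lborel) = v r * (u \<star> g) (t - r)" for r
  proof -
    have "h r s = v r * (u s * g (t - r - s))" for s
      by (simp add: h_def algebra_simps)
    then show ?thesis unfolding convolution_def by simp
  qed
  ultimately show "(u \<star> (v \<star> g)) t = (v \<star> (u \<star> g)) t"
    unfolding convolution_def[of u "v \<star> g"] convolution_def[of v "u \<star> g"] by simp
qed

lemma convolution_tendsto:
  assumes u: "\<And>n. kernel_on a b (u n)" "\<And>n s. norm (u n s) \<le> A"
    and g: "\<And>n. continuous_on UNIV (g n)" "\<And>n s. norm (g n s) \<le> B"
    and lim: "\<And>s. (\<lambda>n. u n s) \<longlonglongrightarrow> u0 s" "\<And>s. (\<lambda>n. g n s) \<longlonglongrightarrow> g0 s"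
  shows "(\<lambda>n. (u n \<star> g n) t) \<longlonglongrightarrow> (u0 \<star> g0) t"
  unfolding convolution_def
proof (rule integral_dominated_convergence[where w = "\<lambda>s. A * B * indicator {a..b} s"])
  have meas: "(\<lambda>s. u n s * g n (t - s)) \<in> borel_measurable lborel" for n
    by (rule borel_measurable_integrable[OF convolution_integrable[OF u(1) g(1)]])
  then show "(\<lambda>s. u n s * g n (t - s)) \<in> borel_measurable lborel" for n .
  have tend: "(\<lambda>n. u n s * g n (t - s)) \<longlonglongrightarrow> u0 s * g0 (t - s)" for s
    by (intro tendsto_mult lim)
  then show "AE s in lborel. (\<lambda>n. u n s * g n (t - s)) \<longlonglongrightarrow> u0 s * g0 (t - s)" by simp
  show "(\<lambda>s. u0 s * g0 (t - s)) \<in> borel_measurable lborel"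
    by (rule borel_measurable_LIMSEQ_metric[OF meas tend])
  have "A \<ge> 0" "B \<ge> 0"
    using u(2)[of 0 0] g(2)[of 0 0] norm_ge_zero order_trans by blast+
  then have "norm (u n s * g n (t - s)) \<le> A * B * indicator {a..b} s" for n s
    using u(1)[of n] mult_mono[OF u(2)[of n s] g(2)[of n "t - s"]]
    by (cases "s \<in> {a..b}") (auto simp: norm_mult kernel_on_def)
  then show "AE s in lborel. norm (u n s * g n (t - s)) \<le> A * B * indicator {a..b} s" for n
    by simp
  show "integrable lborel (\<lambda>s. A * B * indicator {a..b} s)"
    by (intro integrable_mult_right) (simp add: integrable_indicator_iff emeasure_lborel_Icc_eq)
qed

lemma kernel_on_continuous: "continuous_on UNIV u \<Longrightarrow> (\<And>s. s \<notin> {a..b} \<Longrightarrow> u s = 0) \<Longrightarrow> kernel_on a b u"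
  unfolding kernel_on_def using continuous_on_subset by blast

lemma kernel_on_test_function:
  assumes "f \<in> test_functions"
  obtains R where "R > 0" "kernel_on (-R) R f"
  using test_function_supportE[OF assms] kernel_on_continuous
    smooth_continuous_on[OF test_function_smooth[OF assms]] by metis

lemma test_function_convolution:
  assumes "f \<in> test_functions" "g \<in> test_functions"
  shows "f \<star> g \<in> test_functions"
proof -
  obtain R S where "kernel_on (-R) R f" and S: "kernel_on (-S) S g"
    using kernel_on_test_function assms by metis
  then have "kernel_on (- R + - S) (R + S) (f \<star> g)"
    by (intro convolution_kernel_on smooth_continuous_on[OF test_function_smooth[OF assms(2)]])
      (auto simp: kernel_on_def)
  then show ?thesis
    using \<open>kernel_on (-R) R f\<close>
    by (intro test_functionI[where a = "- R + - S" and b = "R + S"] smooth_convolution(1)[of "-R" R] test_function_smooth[OF assms(2)])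
      (auto simp: kernel_on_def)
qed

section \<open>A smooth cutoff function\<close>

lemma poly_times_exp_tendsto_0: "((\<lambda>x::real. poly p x * exp (- x)) \<longlongrightarrow> 0) at_top"
proof -
  have "((\<lambda>x. \<Sum>i\<le>degree p. coeff p i * (x ^ i / exp x)) \<longlongrightarrow> (\<Sum>i\<le>degree p. coeff p i * 0)) at_top"
    by (intro tendsto_intros tendsto_power_div_exp_0)
  then show ?thesis
    by (simp add: poly_altdef sum_distrib_right exp_minus divide_inverse mult.assoc)
qed

text \<open>The functions \<open>p(1/t) exp(-1/t)\<close> for \<open>t > 0\<close>, extended by 0. This family is closed under
  differentiation, which makes all its members smooth; \<open>p = 1\<close> is the case of interest.\<close>

definition flat_function :: "real poly \<Rightarrow> real \<Rightarrow> real" where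
  "flat_function p t = (if t \<le> 0 then 0 else poly p (1 / t) * exp (- (1 / t)))"

lemma flat_function_has_real_derivative:
  "(flat_function p has_real_derivative flat_function ([:0, 0, 1:] * (p - pderiv p)) t) (at t)"
proof (cases t "0 :: real" rule: linorder_cases)
  case less
  have "(flat_function p has_real_derivative 0) (at t)"
    by (rule has_field_derivative_transform_within_open[where f = "\<lambda>t. 0" and S = "{..<0}"])
      (use less in \<open>auto simp: flat_function_def\<close>)
  then show ?thesis using less by (simp add: flat_function_def)
next
  case equal
  have "((\<lambda>h. poly ([:0, 1:] * p) (1 / h) * exp (- (1 / h))) \<longlongrightarrow> 0) (at_right 0)"
    using filterlim_compose[OF poly_times_exp_tendsto_0 filterlim_inverse_at_top_right, of "[:0, 1:] * p"]
    by (simp add: divide_inverse)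
  moreover have "eventually (\<lambda>h. poly ([:0, 1:] * p) (1 / h) * exp (- (1 / h)) = flat_function p h / h) (at_right 0)"
    unfolding eventually_at_right_field by (intro exI[of _ 1]) (auto simp: flat_function_def)
  ultimately have "((\<lambda>h. flat_function p h / h) \<longlongrightarrow> 0) (at_right 0)"
    by (rule Lim_transform_eventually)
  moreover have "((\<lambda>h. flat_function p h / h) \<longlongrightarrow> 0) (at_left 0)"
    by (rule Lim_transform_eventually[OF tendsto_const])
      (auto simp: flat_function_def eventually_at_left_field intro: exI[of _ "-1"])
  ultimately have "(\<lambda>h. flat_function p h / h) \<midarrow>0\<rightarrow> 0"
    by (simp add: filterlim_split_at)
  then show ?thesis
    using equal by (simp add: DERIV_def flat_function_def)
next
  case greater
  have "((\<lambda>t. poly p (1 / t) * exp (- (1 / t))) has_real_derivative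
      flat_function ([:0, 0, 1:] * (p - pderiv p)) t) (at t)"
    using greater
    by (auto intro!: derivative_eq_intros DERIV_chain2[OF poly_DERIV]
        simp: flat_function_def field_simps power2_eq_square)
  then show ?thesis
    by (rule has_field_derivative_transform_within_open[where S = "{0<..}"])
      (use greater in \<open>auto simp: flat_function_def\<close>)
qed

lemma smooth_flat_function: "smooth (flat_function p)"
  by (rule smooth_coinduct[where C = "range flat_function"])
    (use flat_function_has_real_derivative in \<open>auto simp: has_real_derivative_iff_has_vector_derivative\<close>)

definition cutoff :: "real \<Rightarrow> (real \<Rightarrow> real) \<Rightarrow> bool" where
  "cutoff \<epsilon> \<theta> \<longleftrightarrow> smooth \<theta> \<and> (\<forall>s \<le> \<epsilon> / 2. \<theta> s = 1) \<and> (\<forall>s \<ge> \<epsilon>. \<theta> s = 0) \<and> (\<forall>s. 0 \<le> \<theta> s \<and> \<theta> s \<le> 1)"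

text \<open>The cutoff is a primitive of the bump \<open>exp(-1/(t - 1/2)) exp(-1/(1 - t))\<close> on \<open>[1/2, 1]\<close>,
  normalized so that it decreases from 1 to 0.\<close>

lemma cutoff_exists_unit: obtains \<theta> where "cutoff 1 \<theta>"
proof -
  define q where "q = (\<lambda>t. flat_function 1 (t - 1/2) * flat_function 1 (1 - t))"
  have "smooth (\<lambda>t. flat_function 1 (1 * t + - (1/2)))"
    by (intro smooth_affine smooth_flat_function)
  then have q: "smooth q"
    unfolding q_def by (intro smooth_mult smooth_reflect smooth_flat_function) simp
  have "\<exists>Q. \<forall>x::real. -\<infinity> < ereal x \<longrightarrow> ereal x < \<infinity> \<longrightarrow> (Q has_vector_derivative q x) (at x)"
    by (rule einterval_antiderivative)
      (use smooth_continuous_on[OF q, of UNIV] in \<open>auto simp: continuous_on_eq_continuous_at\<close>)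
  then obtain Q where Q: "\<And>x. (Q has_real_derivative q x) (at x)"
    by (auto simp: has_real_derivative_iff_has_vector_derivative)
  have q_nonneg: "q t \<ge> 0" for t by (simp add: q_def flat_function_def)
  have q_pos: "q t > 0" if "1/2 < t" "t < 1" for t
    using that by (simp add: q_def flat_function_def)
  have q_zero: "q t = 0" if "t \<le> 1/2 \<or> t \<ge> 1" for t
    using that by (auto simp: q_def flat_function_def)
  have mono: "Q s \<le> Q t" if "s \<le> t" for s t
    using DERIV_nonneg_imp_nondecreasing[OF that] Q q_nonneg by metis
  have left: "Q s = Q (1/2)" if "s \<le> 1/2" for s
  proof -
    have "\<exists>c. \<forall>x\<in>{..1/2}. Q x = c"
      by (rule has_field_derivative_zero_constant)
        (simp, metis Q atMost_iff has_field_derivative_at_within q_zero)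
    then show ?thesis using that by auto
  qed
  have right: "Q s = Q 1" if "s \<ge> 1" for s
  proof -
    have "\<exists>c. \<forall>x\<in>{1..}. Q x = c"
      by (rule has_field_derivative_zero_constant)
        (simp, metis Q atLeast_iff has_field_derivative_at_within q_zero)
    then show ?thesis using that by auto
  qed
  have gap: "Q (1/2) < Q 1"
    by (rule DERIV_pos_imp_increasing_open[where f = Q]) (use Q q_pos in \<open>auto intro!: DERIV_continuous_on intro: has_field_derivative_at_within\<close>)
  have bounds: "Q (1/2) \<le> Q s" "Q s \<le> Q 1" for s
    using left[of s] right[of s] mono[of s 1] mono[of "1/2" s] by (cases "s \<le> 1/2"; cases "s \<ge> 1"; simp)+
  define \<theta> where "\<theta> = (\<lambda>s. (Q 1 - Q s) / (Q 1 - Q (1/2)))"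
  have "(\<theta> has_vector_derivative - 1 / (Q 1 - Q (1/2)) * q s + 0 * q s) (at s)" for s
    unfolding \<theta>_def has_real_derivative_iff_has_vector_derivative[symmetric]
    using gap by (auto intro!: derivative_eq_intros Q)
  then have "smooth \<theta>"
    by (rule smooth_from_derivative) (rule smooth_lincomb[OF q q])
  moreover have "\<theta> s = 1" if "s \<le> 1/2" for s
    using left[OF that] gap by (simp add: \<theta>_def)
  moreover have "\<theta> s = 0" if "s \<ge> 1" for s
    using right[OF that] by (simp add: \<theta>_def)
  moreover have "0 \<le> \<theta> s \<and> \<theta> s \<le> 1" for s
    using gap bounds[of s] by (simp add: \<theta>_def)
  ultimately have "cutoff 1 \<theta>"
    unfolding cutoff_def by blast
  then show ?thesis by (rule that)
qed

lemma cutoff_exists: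
  assumes "\<epsilon> > 0"
  obtains \<theta> where "cutoff \<epsilon> \<theta>"
proof -
  obtain \<theta> where \<theta>: "cutoff 1 \<theta>" using cutoff_exists_unit .
  then have "smooth (\<lambda>s. \<theta> (1 / \<epsilon> * s + 0))"
    unfolding cutoff_def by (intro smooth_affine) auto
  then have "cutoff \<epsilon> (\<lambda>s. \<theta> (1 / \<epsilon> * s + 0))"
    using \<theta> assms by (auto simp: cutoff_def field_simps)
  then show ?thesis by (rule that)
qed

section \<open>Truncated exponential kernels\<close>

text \<open>On \<open>s \<ge> 0\<close> the function \<open>l exp(-ls)\<close> is the fundamental solution of \<open>1 + D/l\<close>. Multiplication
  by the cutoff makes its support compact, at the price of the remainder \<open>exp_remainder\<close>.\<close>

definition exp_kernel :: "real \<Rightarrow> (real \<Rightarrow> real) \<Rightarrow> real \<Rightarrow> 'k::real_normed_field" where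
  "exp_kernel l \<theta> s = (if s < 0 then 0 else of_real (l * exp (- l * s) * \<theta> s))"

definition exp_remainder :: "real \<Rightarrow> (real \<Rightarrow> real) \<Rightarrow> real \<Rightarrow> 'k::real_normed_field" where
  "exp_remainder l \<theta> s = of_real (exp (- l * s)) * of_real (- iter_deriv (Suc 0) \<theta> s)"

lemma cutoff_has_derivative:
  assumes "cutoff \<epsilon> \<theta>"
  shows "(\<theta> has_real_derivative iter_deriv (Suc 0) \<theta> s) (at s)"
  using iter_deriv_has_vector_derivative[of \<theta> 0 s] assms
  by (simp add: cutoff_def has_real_derivative_iff_has_vector_derivative)

lemma cutoff_deriv_zero:
  assumes "cutoff \<epsilon> \<theta>" "s \<notin> {\<epsilon> / 2..\<epsilon>}"
  shows "iter_deriv (Suc 0) \<theta> s = 0"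
proof -
  have "(\<theta> has_real_derivative 0) (at s)"
  proof (cases "s < \<epsilon> / 2")
    case True
    show ?thesis
      by (rule has_field_derivative_transform_within_open[where f = "\<lambda>t. 1" and S = "{..<\<epsilon>/2}"])
        (use assms True in \<open>auto simp: cutoff_def\<close>)
  next
    case False
    then have "s > \<epsilon>" using assms(2) by auto
    then show ?thesis
      using assms(1)
      by (intro has_field_derivative_transform_within_open[OF DERIV_const open_greaterThan])
        (auto simp: cutoff_def)
  qed
  then show ?thesis
    by (rule DERIV_unique[OF cutoff_has_derivative[OF assms(1)]])
qed

lemma smooth_cutoff_deriv: "cutoff \<epsilon> \<theta> \<Longrightarrow> smooth (\<lambda>s. of_real (- iter_deriv (Suc 0) \<theta> s) :: 'k::real_normed_field)"
  using smooth_of_real[OF smooth_lincomb[OF smooth_iter_deriv smooth_iter_deriv], of \<theta> \<theta> "-1" 1 0 0]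
  by (simp add: cutoff_def)

lemma smooth_exp_remainder:
  assumes "cutoff \<epsilon> \<theta>"
  shows "smooth (exp_remainder l \<theta> :: real \<Rightarrow> 'k::real_normed_field)"
  unfolding exp_remainder_def
  by (intro smooth_mult smooth_of_real smooth_exp smooth_cutoff_deriv[OF assms])

lemma exp_remainder_zero_outside:
  "cutoff \<epsilon> \<theta> \<Longrightarrow> s \<notin> {\<epsilon> / 2..\<epsilon>} \<Longrightarrow> exp_remainder l \<theta> s = 0"
  by (simp add: exp_remainder_def cutoff_deriv_zero)

lemma exp_remainder_kernel_on:
  assumes "cutoff \<epsilon> \<theta>" "\<epsilon> > 0"
  shows "kernel_on 0 \<epsilon> (exp_remainder l \<theta> :: real \<Rightarrow> 'k::real_normed_field)"
  using assms
  by (intro kernel_on_continuous smooth_continuous_on smooth_exp_remainder exp_remainder_zero_outside) auto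

lemma exp_kernel_kernel_on:
  assumes "cutoff \<epsilon> \<theta>"
  shows "kernel_on 0 \<epsilon> (exp_kernel l \<theta> :: real \<Rightarrow> 'k::real_normed_field)"
proof -
  have "continuous_on {0..\<epsilon>} (\<lambda>s. of_real (l * exp (- l * s) * \<theta> s) :: 'k)"
    using assms by (intro continuous_intros smooth_continuous_on) (auto simp: cutoff_def)
  also have "?this \<longleftrightarrow> continuous_on {0..\<epsilon>} (exp_kernel l \<theta> :: real \<Rightarrow> 'k)"
    by (intro continuous_on_cong) (auto simp: exp_kernel_def)
  finally show ?thesis
    using assms by (auto simp: kernel_on_def exp_kernel_def cutoff_def)
qed

text \<open>The kernel is dominated by \<open>l exp(-ls)\<close> on \<open>s \<ge> 0\<close>, which has mass 1. Convolution with
  any number of such kernels therefore does not increase the supremum norm.\<close>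

lemma norm_exp_kernel_convolution_le:
  fixes f :: "real \<Rightarrow> 'k::{real_normed_field, euclidean_space}"
  assumes \<theta>: "cutoff \<epsilon> \<theta>" and "\<epsilon> > 0" "l > 0"
    and f: "continuous_on UNIV f" "\<And>s. norm (f s) \<le> M"
  shows "norm ((exp_kernel l \<theta> \<star> f) t) \<le> M"
proof -
  define w where "w = (\<lambda>s. indicator {0..\<epsilon>} s *\<^sub>R (l * exp (- l * s)))"
  have "integrable lborel w"
    unfolding w_def by (intro borel_integrable_compact) (auto intro!: continuous_intros)
  moreover have "(\<integral>s. w s \<partial>lborel) = - exp (- l * \<epsilon>) - (- exp (- l * 0))"
    unfolding w_def using \<open>\<epsilon> > 0\<close>
    by (intro integral_FTC_Icc)
      (auto intro!: derivative_eq_intros continuous_intros simp flip: has_real_derivative_iff_has_vector_derivative)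
  then have "(\<integral>s. w s \<partial>lborel) \<le> 1" by simp
  moreover have "norm (exp_kernel l \<theta> s :: 'k) \<le> w s" for s
  proof -
    have "0 \<le> \<theta> s" "\<theta> s \<le> 1" using \<theta> by (auto simp: cutoff_def)
    moreover have "s > \<epsilon> \<Longrightarrow> \<theta> s = 0" using \<theta> by (auto simp: cutoff_def)
    ultimately show ?thesis
      using \<open>l > 0\<close>
      by (cases "s > \<epsilon>") (auto simp: exp_kernel_def w_def norm_mult mult_left_le)
  qed
  ultimately have "norm ((exp_kernel l \<theta> \<star> f) t) \<le> 1 * M"
    by (intro norm_convolution_le[OF exp_kernel_kernel_on[OF \<theta>] f(1)] f(2))
  then show ?thesis by simp
qed

text \<open>This is the equation \<open>(1 + D/l) k = \<delta> - g\<close>, tested on a merely continuous function: convolution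
  with \<open>k\<close> gains a derivative. The kernel is a smooth function \<open>\<kappa>\<close> on the line minus the part of
  \<open>\<kappa>\<close> on \<open>s < 0\<close>, where the cutoff is 1. The first part is differentiated under the integral, and
  the second is an exponential times an integral with variable limit.\<close>

lemma exp_kernel_convolution_has_vector_derivative:
  fixes f :: "real \<Rightarrow> 'k::{real_normed_field, euclidean_space}"
  assumes \<theta>: "cutoff \<epsilon> \<theta>" and "\<epsilon> > 0"
    and f: "continuous_on UNIV f" "kernel_on a b f"
  shows "((exp_kernel l \<theta> \<star> f) has_vector_derivative
    l *\<^sub>R (f t - (exp_remainder l \<theta> \<star> f) t - (exp_kernel l \<theta> \<star> f) t)) (at t)"
proof -
  define \<kappa> :: "real \<Rightarrow> 'k" where "\<kappa> = (\<lambda>s. of_real (l * exp (- l * s) * \<theta> s))"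
  define w where "w = (\<lambda>u. of_real (exp (l * u)) * f u)"
  let ?g = "exp_remainder l \<theta> :: real \<Rightarrow> 'k" and ?k = "exp_kernel l \<theta> :: real \<Rightarrow> 'k"
  have smooth_\<theta>: "smooth \<theta>" using \<theta> by (simp add: cutoff_def)
  have \<kappa>: "(\<kappa> has_vector_derivative (- l) *\<^sub>R \<kappa> s - l *\<^sub>R ?g s) (at s)" for s
  proof -
    have "((\<lambda>s. l * exp (- l * s) * \<theta> s) has_real_derivative
        - l * (l * exp (- l * s) * \<theta> s) - l * (exp (- l * s) * - iter_deriv (Suc 0) \<theta> s)) (at s)"
      by (auto intro!: derivative_eq_intros cutoff_has_derivative[OF \<theta>] simp: algebra_simps)
    from has_vector_derivative_of_real[OF this, where ?'a = 'k]
    show ?thesis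
      by (simp add: \<kappa>_def exp_remainder_def scaleR_conv_of_real algebra_simps)
  qed
  have cont_\<kappa>: "continuous_on UNIV \<kappa>"
    unfolding \<kappa>_def by (intro continuous_intros smooth_continuous_on smooth_\<theta>)
  have cont_g: "continuous_on UNIV ?g"
    by (intro smooth_continuous_on smooth_exp_remainder[OF \<theta>])
  have "((f \<star> \<kappa>) has_vector_derivative (f \<star> (\<lambda>s. (- l) *\<^sub>R \<kappa> s - l *\<^sub>R ?g s)) t) (at t)"
    by (intro convolution_has_vector_derivative[OF f(2) \<kappa>] continuous_intros cont_\<kappa> cont_g)
  also have "f \<star> (\<lambda>s. (- l) *\<^sub>R \<kappa> s - l *\<^sub>R ?g s) = (\<lambda>t. (- l) *\<^sub>R (f \<star> \<kappa>) t - l *\<^sub>R (f \<star> ?g) t)"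
    by (subst convolution_diff_right[OF f(2)])
      (auto intro!: continuous_intros cont_\<kappa> cont_g simp only: convolution_scaleR_right)
  finally have d1: "((f \<star> \<kappa>) has_vector_derivative (- l) *\<^sub>R (f \<star> \<kappa>) t - l *\<^sub>R (f \<star> ?g) t) (at t)" .

  \<comment> \<open>\<open>f\<close> vanishes beyond \<open>c\<close>, so integrals over \<open>u > r\<close> may be taken over \<open>[r, c]\<close>; the slack 1
    keeps \<open>c\<close> away from \<open>t\<close>.\<close>
  define c where "c = max b t + 1"
  have cont_w: "continuous_on UNIV w"
    unfolding w_def by (intro continuous_intros f(1))
  have "\<exists>W. \<forall>x::real. -\<infinity> < ereal x \<longrightarrow> ereal x < \<infinity> \<longrightarrow> (W has_vector_derivative w x) (at x)"
    by (rule einterval_antiderivative)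
      (use cont_w in \<open>auto simp: continuous_on_eq_continuous_at\<close>)
  then obtain W where W: "\<And>x. (W has_vector_derivative w x) (at x)"
    by auto
  have rep: "(f \<star> ?k) r = (f \<star> \<kappa>) r - of_real (l * exp (- l * r)) * (W c - W r)" if "r < c" for r
  proof -
    have "(\<integral>u. indicator {r..c} u *\<^sub>R w u \<partial>lborel) = W c - W r"
      by (rule integral_FTC_Icc[OF less_imp_le[OF that] has_vector_derivative_at_within[OF W]
          continuous_on_subset[OF cont_w subset_UNIV]])
    then have "of_real (l * exp (- l * r)) * (W c - W r) =
        (\<integral>u. of_real (l * exp (- l * r)) * (indicator {r..c} u *\<^sub>R w u) \<partial>lborel)"
      by (simp only: integral_mult_right_zero)
    also have "\<dots> = (\<integral>u. f u * \<kappa> (r - u) - f u * ?k (r - u) \<partial>lborel)"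
    \<comment> \<open>At the single point \<open>u = r\<close> the integrands may differ.\<close>
    proof (rule integral_discrete_difference[where X = "{r}"])
      fix u assume "u \<notin> {r}"
      then consider "u < r" | "u > r" "u \<le> c" | "u > c" using that by fastforce
      then show "of_real (l * exp (- l * r)) * (indicator {r..c} u *\<^sub>R w u) = f u * \<kappa> (r - u) - f u * ?k (r - u)"
      proof cases
        case 2
        moreover have "\<theta> (r - u) = 1" using \<theta> \<open>\<epsilon> > 0\<close> 2 by (simp add: cutoff_def)
        moreover have "exp (- (l * r)) * exp (l * u) = exp (- l * (r - u))"
          by (simp add: exp_add[symmetric] algebra_simps)
        then have "of_real (exp (- (l * r))) * of_real (exp (l * u)) = (of_real (exp (- l * (r - u))) :: 'k)"
          by (metis of_real_mult)
        ultimately show ?thesis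
          by (simp add: \<kappa>_def exp_kernel_def w_def)
      next
        case 3
        then have "u \<notin> {a..b}" by (auto simp: c_def)
        then have "f u = 0" using f(2) by (simp add: kernel_on_def)
        then show ?thesis using 3 by simp
      qed (simp add: \<kappa>_def exp_kernel_def)
    qed auto
    also have "\<dots> = (f \<star> \<kappa>) r - (f \<star> ?k) r"
    proof -
      have "integrable lborel (\<lambda>u. f u * \<kappa> (r - u))"
        by (rule convolution_integrable[OF f(2) cont_\<kappa>])
      moreover have "integrable lborel (\<lambda>u. f u * ?k (r - u))"
      proof -
        have "integrable lborel (\<lambda>s. ?k s * f (r - s))"
          by (rule convolution_integrable[OF exp_kernel_kernel_on[OF \<theta>] f(1)])
        from lborel_integrable_real_affine[OF this, of "-1" r]
        show ?thesis by (simp add: mult.commute)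
      qed
      ultimately show ?thesis by (simp add: convolution_def)
    qed
    finally show ?thesis by simp
  qed
  have d2: "((\<lambda>r. of_real (l * exp (- l * r)) * (W c - W r)) has_vector_derivative
      of_real (l * exp (- l * t)) * (0 - w t) + of_real (l * (- l * exp (- l * t))) * (W c - W t)) (at t)"
    by (intro has_vector_derivative_mult has_vector_derivative_diff has_vector_derivative_const W
        has_vector_derivative_of_real) (auto intro!: derivative_eq_intros)
  have "((f \<star> ?k) has_vector_derivative ((- l) *\<^sub>R (f \<star> \<kappa>) t - l *\<^sub>R (f \<star> ?g) t) -
      (of_real (l * exp (- l * t)) * (0 - w t) + of_real (l * (- l * exp (- l * t))) * (W c - W t))) (at t)"
    by (rule has_vector_derivative_transform_within_open[OF has_vector_derivative_diff[OF d1 d2], where S = "{..<c}"])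
      (use rep in \<open>auto simp: c_def\<close>)
  moreover have "((- l) *\<^sub>R (f \<star> \<kappa>) t - l *\<^sub>R (f \<star> ?g) t) -
      (of_real (l * exp (- l * t)) * (0 - w t) + of_real (l * (- l * exp (- l * t))) * (W c - W t))
    = l *\<^sub>R (f t - (f \<star> ?g) t - (f \<star> ?k) t)"
  proof -
    have "of_real (exp (- l * t)) * of_real (exp (l * t)) = (of_real (exp (- l * t) * exp (l * t)) :: 'k)"
      by simp
    also have "\<dots> = 1" by (simp flip: exp_add)
    finally have 1: "of_real (l * exp (- l * t)) * (0 - w t) = - (l *\<^sub>R f t)"
      by (simp add: w_def scaleR_conv_of_real mult.assoc)
    have 2: "of_real (l * (- l * exp (- l * t))) * (W c - W t)
        = - (l *\<^sub>R (of_real (l * exp (- l * t)) * (W c - W t)))"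
      by (simp add: scaleR_conv_of_real mult.assoc)
    have 3: "(f \<star> \<kappa>) t = (f \<star> ?k) t + of_real (l * exp (- l * t)) * (W c - W t)"
      using rep[of t] by (simp add: c_def)
    show ?thesis
      unfolding 1 2 3 by (simp add: scaleR_add_right scaleR_diff_right)
  qed
  ultimately have "((f \<star> ?k) has_vector_derivative l *\<^sub>R (f t - (f \<star> ?g) t - (f \<star> ?k) t)) (at t)"
    by (simp only:)
  then show ?thesis
    by (simp only: convolution_commute[of f])
qed

text \<open>By the differential equation, \<open>f - k * f = g * f + (k * f')/l\<close>, and both terms are small.\<close>

lemma exp_kernel_approximates:
  fixes f :: "real \<Rightarrow> 'k::{real_normed_field, euclidean_space}"
  assumes \<theta>: "cutoff \<epsilon> \<theta>" and "\<epsilon> > 0" "l > 0"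
    and f: "kernel_on a b f" "\<And>s. norm (f s) \<le> M"
    and f': "\<And>s. (f has_vector_derivative f' s) (at s)" "continuous_on UNIV f'" "\<And>s. norm (f' s) \<le> M'"
    and g: "\<And>s. norm (exp_remainder l \<theta> s :: 'k) \<le> \<delta>"
  shows "norm ((exp_kernel l \<theta> \<star> f) t - f t) \<le> \<epsilon> * \<delta> * M + M' / l"
proof -
  let ?g = "exp_remainder l \<theta> :: real \<Rightarrow> 'k" and ?k = "exp_kernel l \<theta> :: real \<Rightarrow> 'k"
  have f_cont: "continuous_on UNIV f"
    using f'(1) by (meson continuous_at_imp_continuous_on has_vector_derivative_continuous)
  have "l *\<^sub>R (f t - (?g \<star> f) t - (?k \<star> f) t) = (?k \<star> f') t"
    using vector_derivative_unique_at exp_kernel_convolution_has_vector_derivative[OF \<theta> \<open>\<epsilon> > 0\<close> f_cont f(1)]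
      convolution_has_vector_derivative[OF exp_kernel_kernel_on[OF \<theta>] f'(1,2)] by blast
  then have "(?k \<star> f) t - f t = - ((?g \<star> f) t) - (1 / l) *\<^sub>R (?k \<star> f') t"
    using \<open>l > 0\<close> by (simp add: field_simps flip: \<open>l *\<^sub>R _ = _\<close>)
  also have "norm \<dots> \<le> norm ((?g \<star> f) t) + norm ((1 / l) *\<^sub>R (?k \<star> f') t)"
    using norm_triangle_ineq4[of "- ((?g \<star> f) t)" "(1 / l) *\<^sub>R (?k \<star> f') t"]
    by (simp only: norm_minus_cancel)
  also have "\<dots> \<le> (\<epsilon> - 0) * \<delta> * M + 1 / l * M'"
  proof (rule add_mono)
    show "norm ((?g \<star> f) t) \<le> (\<epsilon> - 0) * \<delta> * M"
      using \<open>\<epsilon> > 0\<close> by (intro norm_convolution_le_sup exp_remainder_kernel_on \<theta> f_cont f g) auto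
    have "norm ((?k \<star> f') t) \<le> M'"
      by (intro norm_exp_kernel_convolution_le[OF \<theta>] assms)
    then show "norm ((1 / l) *\<^sub>R (?k \<star> f') t) \<le> 1 / l * M'"
      using \<open>l > 0\<close> by (simp add: divide_right_mono)
  qed
  finally show ?thesis by simp
qed

text \<open>Each derivative brings down a factor \<open>l\<close>, but \<open>h\<close> vanishes for \<open>s < a\<close> and \<open>exp(-la)\<close> beats every
  power of \<open>l\<close>. The power in the statement absorbs these factors in the induction on the order.\<close>

lemma exp_damping_derivs_tendsto_0:
  fixes h :: "real \<Rightarrow> 'k::{real_normed_field, euclidean_space}"
  assumes "smooth h" "\<And>s. s \<notin> {a..b} \<Longrightarrow> h s = 0" "a > 0" "e > 0"
  shows "eventually (\<lambda>l. \<forall>t. l ^ m * norm (iter_deriv k (\<lambda>s. of_real (exp (- l * s)) * h s) t) \<le> e) at_top"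
  using assms(1,2,4)
proof (induction k arbitrary: h m e)
  case 0
  obtain M where M: "M > 0" "\<And>s. norm (h s) \<le> M"
    using bounded_of_compact_support[of a b h] smooth_continuous_on 0 by metis
  have "((\<lambda>l. (a * l) ^ m / exp (a * l)) \<longlongrightarrow> 0) at_top"
    using \<open>a > 0\<close>
    by (intro filterlim_compose[OF tendsto_power_div_exp_0] filterlim_tendsto_pos_mult_at_top[OF tendsto_const]
        filterlim_ident)
  then have "((\<lambda>l. M / a ^ m * ((a * l) ^ m / exp (a * l))) \<longlongrightarrow> 0) at_top"
    by (rule tendsto_mult_right_zero)
  from order_tendstoD(2)[OF this \<open>e > 0\<close>] eventually_ge_at_top[of 0]
  show ?case
  proof eventually_elim
    case (elim l)
    have "l ^ m * norm (of_real (exp (- l * s)) * h s) \<le> e" for s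
    proof (cases "s \<in> {a..b}")
      case True
      then have "exp (- l * s) \<le> exp (- l * a)"
        using elim(2) by (simp add: mult_left_mono)
      then have "l ^ m * norm (of_real (exp (- l * s)) * h s) \<le> l ^ m * (exp (- l * a) * M)"
        using M elim(2) by (intro mult_left_mono) (auto simp: norm_mult intro: mult_mono)
      also have "\<dots> = M / a ^ m * ((a * l) ^ m / exp (a * l))"
        using \<open>a > 0\<close> by (simp add: exp_minus field_simps)
      also have "\<dots> \<le> e" using elim(1) by simp
      finally show ?thesis .
    qed (use 0 in auto)
    then show ?case by simp
  qed
next
  case (Suc k)
  have h': "smooth (iter_deriv (Suc 0) h)" "\<And>s. s \<notin> {a..b} \<Longrightarrow> iter_deriv (Suc 0) h s = 0"
    by (rule smooth_iter_deriv[OF Suc.prems(1)], rule iter_deriv_zero_outside[OF Suc.prems(2)])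
  have "eventually (\<lambda>l. \<forall>t. l ^ m * norm (iter_deriv k (\<lambda>s. of_real (exp (- l * s)) * iter_deriv (Suc 0) h s) t) \<le> e / 2) at_top"
    by (rule Suc.IH) (use h' Suc.prems in auto)
  moreover have "eventually (\<lambda>l. \<forall>t. l ^ Suc m * norm (iter_deriv k (\<lambda>s. of_real (exp (- l * s)) * h s) t) \<le> e / 2) at_top"
    by (rule Suc.IH) (use Suc.prems in auto)
  ultimately show ?case
    using eventually_ge_at_top[of 0]
  proof eventually_elim
    case (elim l)
    define E where "E = (\<lambda>h s. of_real (exp (- l * s)) * h s :: 'k)"
    have E: "smooth (E h)" if "smooth h" for h
      unfolding E_def by (intro smooth_mult smooth_of_real smooth_exp that)
    have "(E h has_vector_derivative 1 * E (iter_deriv (Suc 0) h) s + of_real (- l) * E h s) (at s)" for s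
    proof -
      have "(E h has_vector_derivative of_real (exp (- l * s)) * iter_deriv (Suc 0) h s + of_real (- l * exp (- l * s)) * h s) (at s)"
        unfolding E_def using iter_deriv_has_vector_derivative[OF Suc.prems(1), of 0]
        by (intro has_vector_derivative_mult has_vector_derivative_of_real) (auto intro!: derivative_eq_intros)
      then show ?thesis by (simp add: E_def mult.assoc)
    qed
    then have "iter_deriv (Suc 0) (E h) = (\<lambda>s. 1 * E (iter_deriv (Suc 0) h) s + of_real (- l) * E h s)"
      by (rule iter_deriv_1)
    then have "iter_deriv (Suc k) (E h) = iter_deriv k (\<lambda>s. 1 * E (iter_deriv (Suc 0) h) s + of_real (- l) * E h s)"
      using iter_deriv_iter_deriv[OF E[OF Suc.prems(1)], of k "Suc 0"] by simp
    also have "\<dots> = (\<lambda>s. 1 * iter_deriv k (E (iter_deriv (Suc 0) h)) s + of_real (- l) * iter_deriv k (E h) s)"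
      by (intro iter_deriv_lincomb E h' Suc.prems)
    finally have eq: "iter_deriv (Suc k) (E h) t = iter_deriv k (E (iter_deriv (Suc 0) h)) t - l *\<^sub>R iter_deriv k (E h) t" for t
      by (simp add: scaleR_conv_of_real)
    have "l ^ m * norm (iter_deriv (Suc k) (E h) t) \<le> e" for t
    proof -
      have "l ^ m * norm (iter_deriv (Suc k) (E h) t)
          \<le> l ^ m * (norm (iter_deriv k (E (iter_deriv (Suc 0) h)) t) + l * norm (iter_deriv k (E h) t))"
        unfolding eq using elim(3) norm_triangle_ineq4[of "iter_deriv k (E (iter_deriv (Suc 0) h)) t" "l *\<^sub>R iter_deriv k (E h) t"]
        by (intro mult_left_mono) auto
      also have "\<dots> \<le> e / 2 + e / 2"
        using elim(1,2)[rule_format, of t] unfolding E_def by (simp add: algebra_simps)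
      finally show ?thesis by simp
    qed
    then show ?case by (simp add: E_def)
  qed
qed

lemma exp_remainder_derivs_small:
  assumes \<theta>: "cutoff \<epsilon> \<theta>" and "\<epsilon> > 0" "e > 0"
  shows "eventually (\<lambda>l. \<forall>k\<le>N. \<forall>t.
    norm (iter_deriv k (exp_remainder l \<theta> :: real \<Rightarrow> 'k::{real_normed_field, euclidean_space}) t) \<le> e) at_top"
proof -
  have "eventually (\<lambda>l. \<forall>t. norm (iter_deriv k (exp_remainder l \<theta> :: real \<Rightarrow> 'k) t) \<le> e) at_top" for k
  proof -
    have "eventually (\<lambda>l. \<forall>t. l ^ 0 *
        norm (iter_deriv k (\<lambda>s. of_real (exp (- l * s)) * (of_real (- iter_deriv (Suc 0) \<theta> s) :: 'k)) t) \<le> e) at_top"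
      by (rule exp_damping_derivs_tendsto_0[OF smooth_cutoff_deriv[OF \<theta>], where a = "\<epsilon> / 2" and b = \<epsilon>])
        (use assms cutoff_deriv_zero[OF \<theta>] in auto)
    then show ?thesis by (simp add: exp_remainder_def[abs_def])
  qed
  then have "eventually (\<lambda>l. \<forall>k\<in>{..N}. \<forall>t. norm (iter_deriv k (exp_remainder l \<theta> :: real \<Rightarrow> 'k) t) \<le> e) at_top"
    by (intro eventually_ball_finite) auto
  then show ?thesis by (simp add: Ball_def)
qed

section \<open>The Dixmier--Malliavin factorization\<close>

lemma convolution_zero_left: "(\<lambda>t. 0) \<star> f = (\<lambda>t. 0)"
  by (simp add: convolution_def)

text \<open>A compactly supported kernel with \<open>D\<^sup>3 K = \<delta> - g\<close>: the fundamental solution \<open>s\<^sup>2/2\<close> of \<open>D\<^sup>3\<close> on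
  \<open>s \<ge> 0\<close>, multiplied by a cutoff. The order 3 is the least for which \<open>K\<close> is continuously
  differentiable, so that convolutions of \<open>K\<close> with the truncated exponentials approximate \<open>K\<close>
  at a known rate.\<close>

lemma quadratic_kernel_exists:
  obtains K K' g :: "real \<Rightarrow> 'k::{real_normed_field, euclidean_space}" where
    "\<And>t. (K has_vector_derivative K' t) (at t)" "continuous_on UNIV K'"
    "\<And>t. t \<notin> {0..1} \<Longrightarrow> K t = 0" "\<And>t. t \<notin> {0..1} \<Longrightarrow> K' t = 0"
    "smooth g" "\<And>t. t \<notin> {0..1} \<Longrightarrow> g t = 0"
    "\<And>\<phi>. smooth \<phi> \<Longrightarrow> K \<star> iter_deriv 3 \<phi> = (\<lambda>t. \<phi> t - (g \<star> \<phi>) t)"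
proof -
  obtain \<theta> where \<theta>: "cutoff (1/2) \<theta>" using cutoff_exists[of "1/2"] by auto
  define p where "p = (\<lambda>s::real. s * s * (1/2))"
  define m where "m = (\<lambda>s. p s * \<theta> s)"
  define P where "P = (\<lambda>n (s::real). (case n of 0 \<Rightarrow> s * s * (1/2) | Suc 0 \<Rightarrow> s | Suc (Suc 0) \<Rightarrow> 1 | _ \<Rightarrow> (0::real)))"
  have P: "(P n has_vector_derivative P (Suc n) s) (at s)" for n s
    unfolding P_def
    by (auto split: nat.split intro!: derivative_eq_intros simp flip: has_real_derivative_iff_has_vector_derivative)
  have p: "smooth p" and iter_p: "iter_deriv n p = P n" for n
    by (rule derivative_tower[where H = P]; use P in \<open>auto simp: P_def p_def\<close>)+
  have m: "smooth m"
    unfolding m_def using p \<theta> by (intro smooth_mult) (auto simp: cutoff_def)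
  define M where "M = (\<lambda>n s. iter_deriv n m s)"
  have M_deriv: "(M n has_real_derivative M (Suc n) s) (at s)" for n s
    using iter_deriv_has_vector_derivative[OF m]
    by (simp add: M_def has_real_derivative_iff_has_vector_derivative)
  have M_cont: "continuous_on S (M n)" for n S
    unfolding M_def by (rule smooth_iter_deriv_continuous_on[OF m])
  have M_small: "M n s = P n s" if "s < 1/4" for n s
    unfolding M_def iter_p[symmetric]
    by (rule iter_deriv_cong_open[OF p open_lessThan[of "1/4"]])
      (use \<theta> that in \<open>auto simp: m_def cutoff_def\<close>)
  have M_large: "M n s = 0" if "s > 1/2" for n s
    unfolding M_def
    by (subst iter_deriv_cong_open[OF smooth_const[of 0] open_greaterThan[of "1/2"]])
      (use \<theta> that in \<open>auto simp: m_def cutoff_def iter_deriv_zero\<close>)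
  define K :: "real \<Rightarrow> 'k" where "K = (\<lambda>s. of_real (M 0 (max 0 s)))"
  define K' :: "real \<Rightarrow> 'k" where "K' = (\<lambda>s. of_real (M 1 (max 0 s)))"
  define g :: "real \<Rightarrow> 'k" where "g = (\<lambda>s. of_real (- M 3 s))"
  have "((\<lambda>s. M 0 (max 0 s)) has_real_derivative M 1 (max 0 s)) (at s)" for s
  proof (cases s "0::real" rule: linorder_cases)
    case less
    have "((\<lambda>s. M 0 (max 0 s)) has_real_derivative 0) (at s)"
      by (rule has_field_derivative_transform_within_open[OF DERIV_const[of 0] open_lessThan[of 0]])
        (use less in \<open>auto simp: M_small P_def\<close>)
    then show ?thesis using less by (simp add: M_small P_def)
  next
    case equal
    have "\<forall>\<^sub>F h in at 0. norm (M 0 (max 0 h) / h) \<le> norm h"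
      unfolding eventually_at
      by (intro exI[of _ "1/4"]) (auto simp: M_small P_def dist_norm abs_mult max_def)
    moreover have "((\<lambda>h. norm (h::real)) \<longlongrightarrow> 0) (at 0)"
      by (intro tendsto_norm_zero tendsto_ident_at)
    ultimately have "(\<lambda>h. M 0 (max 0 h) / h) \<midarrow>0\<rightarrow> 0"
      by (rule Lim_null_comparison)
    then show ?thesis
      using equal by (simp add: DERIV_def M_small P_def)
  next
    case greater
    have "((\<lambda>s. M 0 (max 0 s)) has_real_derivative M (Suc 0) s) (at s)"
      by (rule has_field_derivative_transform_within_open[OF M_deriv open_greaterThan[of 0]])
        (use greater in auto)
    then show ?thesis using greater by simp
  qed
  then have K: "(K has_vector_derivative K' t) (at t)" for t
    unfolding K_def K'_def by (intro has_vector_derivative_of_real)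
  have K'_cont: "continuous_on UNIV K'"
    unfolding K'_def by (intro continuous_intros continuous_on_compose2[OF M_cont[of UNIV]]) auto
  have zero: "K t = 0" "K' t = 0" "g t = 0" if t: "t \<notin> {0..1}" for t
  proof -
    consider "t < 0" | "t > 1"
      using t unfolding atLeastAtMost_iff by linarith
    then show "K t = 0" "K' t = 0" "g t = 0"
      by (cases; simp add: K_def K'_def g_def M_small M_large P_def numeral_3_eq_3)+
  qed
  have g: "smooth g"
    using smooth_of_real[OF smooth_lincomb[OF smooth_iter_deriv[OF m] smooth_iter_deriv[OF m]], of "-1" 3 0 0]
    by (simp add: g_def M_def)
  have K_cont: "continuous_on UNIV K"
    using K by (meson continuous_at_imp_continuous_on has_vector_derivative_continuous)
  have K_ker: "kernel_on 0 1 K" and g_ker: "kernel_on 0 1 g"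
    by (auto intro!: kernel_on_continuous K_cont zero smooth_continuous_on[OF g])
  have "K \<star> iter_deriv 3 \<phi> = (\<lambda>t. \<phi> t - (g \<star> \<phi>) t)" if \<phi>: "smooth \<phi>" for \<phi> :: "real \<Rightarrow> 'k"
  proof
    fix t
    define D where "D = (\<lambda>n s. of_real (M n s) :: 'k)"
    \<comment> \<open>Threefold integration by parts, packed into one primitive; the boundary values vanish at 1,
      and at 0 they leave \<open>\<phi> t\<close> because \<open>m'' = 1\<close> there.\<close>
    define Q where "Q = (\<lambda>s. - (D 0 s * iter_deriv 2 \<phi> (t - s)) - D 1 s * iter_deriv 1 \<phi> (t - s) - D 2 s * iter_deriv 0 \<phi> (t - s))"
    have D: "(D n has_vector_derivative D (Suc n) s) (at s)" for n s
      unfolding D_def by (intro has_vector_derivative_of_real M_deriv)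
    have \<Phi>: "((\<lambda>s. iter_deriv n \<phi> (t - s)) has_vector_derivative - iter_deriv (Suc n) \<phi> (t - s)) (at s)" for n s
    proof -
      have "((\<lambda>s. t - s) has_vector_derivative (-1)) (at s)"
        by (auto intro!: derivative_eq_intros)
      from vector_diff_chain_at[OF this iter_deriv_has_vector_derivative[OF \<phi>]]
      show ?thesis by (simp add: o_def)
    qed
    have DQ: "(Q has_vector_derivative D 0 s * iter_deriv 3 \<phi> (t - s) - D 3 s * \<phi> (t - s)) (at s)" for s
    proof -
      have "(Q has_vector_derivative
          - (D 0 s * - iter_deriv (Suc 2) \<phi> (t - s) + D (Suc 0) s * iter_deriv 2 \<phi> (t - s))
          - (D 1 s * - iter_deriv (Suc 1) \<phi> (t - s) + D (Suc 1) s * iter_deriv 1 \<phi> (t - s))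
          - (D 2 s * - iter_deriv (Suc 0) \<phi> (t - s) + D (Suc 2) s * iter_deriv 0 \<phi> (t - s))) (at s)"
        unfolding Q_def
        by (intro has_vector_derivative_diff has_vector_derivative_minus has_vector_derivative_mult D \<Phi>)
      then show ?thesis
        by (simp add: numeral_3_eq_3 numeral_2_eq_2)
    qed
    have "((\<lambda>s. D 0 s * iter_deriv 3 \<phi> (t - s) - D 3 s * \<phi> (t - s)) has_integral Q 1 - Q 0) {0..1}"
      by (rule fundamental_theorem_of_calculus) (auto intro: has_vector_derivative_at_within DQ)
    moreover have "Q 1 - Q 0 = \<phi> t"
      by (simp add: Q_def D_def M_small M_large P_def numeral_2_eq_2)
    ultimately have "integral {0..1} (\<lambda>s. D 0 s * iter_deriv 3 \<phi> (t - s) - D 3 s * \<phi> (t - s)) = \<phi> t"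
      by (simp add: integral_unique)
    moreover have "(K \<star> iter_deriv 3 \<phi>) t = integral {0..1} (\<lambda>s. D 0 s * iter_deriv 3 \<phi> (t - s))"
      unfolding convolution_eq_integral[OF K_ker smooth_iter_deriv_continuous_on[OF \<phi>]]
      by (intro integral_cong) (simp add: K_def D_def)
    moreover have "(g \<star> \<phi>) t = integral {0..1} (\<lambda>s. - (D 3 s * \<phi> (t - s)))"
      unfolding convolution_eq_integral[OF g_ker smooth_continuous_on[OF \<phi>]]
      by (intro integral_cong) (simp add: g_def D_def)
    moreover have "integral {0..1} (\<lambda>s. D 0 s * iter_deriv 3 \<phi> (t - s) - D 3 s * \<phi> (t - s))
        = integral {0..1} (\<lambda>s. D 0 s * iter_deriv 3 \<phi> (t - s)) - integral {0..1} (\<lambda>s. D 3 s * \<phi> (t - s))"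
      unfolding D_def
      by (intro integral_diff integrable_continuous_real continuous_intros M_cont
          continuous_on_compose2[OF smooth_iter_deriv_continuous_on[OF \<phi>, of UNIV]]
          continuous_on_compose2[OF smooth_continuous_on[OF \<phi>, of UNIV]]) auto
    ultimately show "(K \<star> iter_deriv 3 \<phi>) t = \<phi> t - (g \<star> \<phi>) t"
      by (simp add: diff_eq_eq)
  qed
  with that[OF K K'_cont zero(1,2) g zero(3)] show ?thesis by blast
qed

text \<open>The convolution of \<open>K\<close> with \<open>k\<^sub>m, \<dots>, k\<^sub>m\<^sub>+\<^sub>i\<^sub>-\<^sub>1\<close>. The recursion peels off the kernel of lowest index,
  so that the limits for \<open>i \<rightarrow> \<infinity>\<close> satisfy \<open>F\<^sub>m = k\<^sub>m * F\<^sub>m\<^sub>+\<^sub>1\<close>, and increasing \<open>i\<close> changes only the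
  innermost function.\<close>

primrec iterated_convolution :: "(nat \<Rightarrow> real \<Rightarrow> 'k) \<Rightarrow> (real \<Rightarrow> 'k) \<Rightarrow> nat \<Rightarrow> nat
    \<Rightarrow> real \<Rightarrow> 'k::{real_normed_field, euclidean_space}" where
  "iterated_convolution k K 0 m = K"
| "iterated_convolution k K (Suc i) m = k m \<star> iterated_convolution k K i (Suc m)"

text \<open>Passing from \<open>i\<close> to \<open>i + 1\<close> factors replaces the innermost \<open>K\<close> by a convolution close to \<open>K\<close>; the
  outer kernels do not increase this error, so the infinite convolutions converge uniformly. The
  support of \<open>F\<^sub>m\<close> is bounded by adding up the lengths \<open>2\<^sup>-\<^sup>n\<^sup>-\<^sup>1\<close> for \<open>n \<ge> m\<close>.\<close>

lemma infinite_convolution_exists: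
  fixes K K' :: "real \<Rightarrow> 'k::{real_normed_field, euclidean_space}"
  assumes \<theta>: "\<And>n. cutoff ((1/2) ^ Suc n) (\<theta> n)"
    and l: "\<And>n. l n \<ge> 2 ^ n"
    and g: "\<And>n t. norm (exp_remainder (l n) (\<theta> n) t :: 'k) \<le> (1/2) ^ n"
    and K: "\<And>t. (K has_vector_derivative K' t) (at t)" "continuous_on UNIV K'"
      "\<And>t. t \<notin> {0..1} \<Longrightarrow> K t = 0" "\<And>t. t \<notin> {0..1} \<Longrightarrow> K' t = 0"
  obtains F where
    "\<And>m. continuous_on UNIV (F m)"
    "\<And>m t. t \<notin> {0..1 + (1/2) ^ m} \<Longrightarrow> F m t = 0"
    "\<And>m. F m = exp_kernel (l m) (\<theta> m) \<star> F (Suc m)"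
    "\<And>t. (\<lambda>m. F m t) \<longlonglongrightarrow> K t"
    "\<exists>M. \<forall>m t. norm (F m t) \<le> M"
proof -
  define k where "k = (\<lambda>n. exp_kernel (l n) (\<theta> n) :: real \<Rightarrow> 'k)"
  define T where "T = iterated_convolution k K"
  have l_pos: "l n > 0" for n using l[of n] by (smt (verit) zero_less_power)
  have K_cont: "continuous_on UNIV K"
    using K(1) by (meson continuous_at_imp_continuous_on has_vector_derivative_continuous)
  have K_ker: "kernel_on 0 1 K"
    by (rule kernel_on_continuous[OF K_cont K(3)])
  obtain M where M: "M > 0" "\<And>t. norm (K t) \<le> M"
    using bounded_of_compact_support[of 0 1 K] K_ker unfolding kernel_on_def by metis
  obtain M' where M': "M' > 0" "\<And>t. norm (K' t) \<le> M'"
    using bounded_of_compact_support[of 0 1 K'] K(2,4) continuous_on_subset by (metis subset_UNIV)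
  have k_ker: "kernel_on 0 ((1/2) ^ Suc m) (k m)" for m
    unfolding k_def by (rule exp_kernel_kernel_on[OF \<theta>])
  have T_cont: "continuous_on UNIV (T i m)" for i m
    unfolding T_def
    by (induction i arbitrary: m) (simp_all add: K_cont convolution_continuous[OF k_ker])
  have T_zero: "T i m t = 0" if "t \<notin> {0..1 + (1/2) ^ m}" for i m t
    using that
  proof (induction i arbitrary: m t)
    case 0
    have "t \<notin> {0..1}"
      using 0 zero_le_power[of "1/2 :: real" m] unfolding atLeastAtMost_iff by linarith
    then show ?case using K(3) by (simp add: T_def)
  next
    case (Suc i)
    have "(k m \<star> T i (Suc m)) t = 0"
      by (rule convolution_zero_outside[where a = 0 and b = "(1/2) ^ Suc m" and c = 0 and d = "1 + (1/2) ^ Suc m"])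
        (use k_ker[of m] Suc in \<open>auto simp: kernel_on_def\<close>)
    then show ?case by (simp add: T_def)
  qed
  have contract: "norm ((k m \<star> f) t) \<le> B" if "continuous_on UNIV f" "\<And>t. norm (f t) \<le> B" for m f B t
    unfolding k_def by (rule norm_exp_kernel_convolution_le[OF \<theta> _ l_pos that]) simp
  have T_bound: "norm (T i m t) \<le> M" for i m t
  proof (induction i arbitrary: m t)
    case (Suc i)
    have "norm ((k m \<star> T i (Suc m)) t) \<le> M"
      by (intro contract T_cont Suc)
    then show ?case by (simp add: T_def)
  qed (simp add: T_def M)
  have T_inc: "norm (T (Suc i) m t - T i m t) \<le> (M + M') * (1/2) ^ (m + i)" for i m t
  proof (induction i arbitrary: m t)
    case 0
    have "norm ((k m \<star> K) t - K t) \<le> (1/2) ^ Suc m * (1/2) ^ m * M + M' / l m"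
      unfolding k_def
      by (rule exp_kernel_approximates[OF \<theta> _ l_pos K_ker M(2) K(1,2) M'(2) g]) simp
    also have "\<dots> \<le> (1/2) ^ m * M + M' * (1/2) ^ m"
    proof (rule add_mono)
      have "(1/2::real) ^ Suc m \<le> 1" by (rule power_le_one) auto
      then show "(1/2) ^ Suc m * (1/2) ^ m * M \<le> (1/2) ^ m * M"
        using M(1) by (intro mult_right_mono mult_left_le_one_le) auto
      have "M' / l m \<le> M' / 2 ^ m"
        using M'(1) l[of m] l_pos[of m] by (intro divide_left_mono) auto
      then show "M' / l m \<le> M' * (1/2) ^ m"
        by (simp add: power_one_over)
    qed
    finally show ?case by (simp add: T_def algebra_simps)
  next
    case (Suc i)
    have "T (Suc (Suc i)) m t - T (Suc i) m t = (k m \<star> (\<lambda>t. T (Suc i) (Suc m) t - T i (Suc m) t)) t"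
      unfolding convolution_diff_right[OF k_ker T_cont T_cont] by (simp add: T_def)
    also have "norm \<dots> \<le> (M + M') * (1/2) ^ (Suc m + i)"
      by (intro contract continuous_on_diff T_cont Suc)
    finally show ?case by simp
  qed
  have T_inc': "norm (T (Suc i) m t - T i m t) \<le> (M + M') * (1/2) ^ m * (1/2) ^ i" for i m t
    using T_inc[of i m t] by (simp add: power_add mult.assoc)
  have "\<exists>F. uniform_limit UNIV (\<lambda>i. T i m) F sequentially" for m
    by (rule uniform_limit_geometric[of 0]) (rule T_inc')
  then obtain F where F: "\<And>m. uniform_limit UNIV (\<lambda>i. T i m) (F m) sequentially"
    by metis
  have lim: "(\<lambda>i. T i m t) \<longlonglongrightarrow> F m t" for m t
    using tendsto_uniform_limitI[OF F] by simp
  show ?thesis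
  proof (rule that)
    show "continuous_on UNIV (F m)" for m
      by (rule uniform_limit_theorem[OF _ F]) (auto intro: always_eventually T_cont)
    show "F m t = 0" if "t \<notin> {0..1 + (1/2) ^ m}" for m t
      using LIMSEQ_unique[OF lim[of m t]] T_zero[OF that] by simp
    show "F m = exp_kernel (l m) (\<theta> m) \<star> F (Suc m)" for m
    proof
      fix t
      obtain A where A: "\<And>s. norm (k m s) \<le> A"
        using bounded_of_compact_support[of 0 "(1/2) ^ Suc m" "k m"] k_ker[of m] unfolding kernel_on_def by metis
      have "(\<lambda>i. (k m \<star> T i (Suc m)) t) \<longlonglongrightarrow> (k m \<star> F (Suc m)) t"
        by (rule convolution_tendsto[OF k_ker A T_cont T_bound tendsto_const lim])
      moreover have "(\<lambda>i. (k m \<star> T i (Suc m)) t) \<longlonglongrightarrow> F m t"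
        using LIMSEQ_Suc[OF lim[of m t]] by (simp add: T_def)
      ultimately show "F m t = (exp_kernel (l m) (\<theta> m) \<star> F (Suc m)) t"
        using LIMSEQ_unique unfolding k_def by blast
    qed
    have close: "norm (F m t - K t) \<le> 2 * ((M + M') * (1/2) ^ m)" for m t
    proof (rule LIMSEQ_le_const2[OF tendsto_norm[OF tendsto_diff[OF lim tendsto_const]]])
      show "\<exists>N. \<forall>n\<ge>N. norm (T n m t - K t) \<le> 2 * ((M + M') * (1/2) ^ m)"
        using norm_diff_le_geometric[of "\<lambda>i. T i m t", OF T_inc'] by (simp add: T_def)
    qed
    show "(\<lambda>m. F m t) \<longlonglongrightarrow> K t" for t
    proof -
      have "(\<lambda>m. 2 * ((M + M') * (1/2::real) ^ m)) \<longlonglongrightarrow> 2 * ((M + M') * 0)"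
        by (intro tendsto_intros LIMSEQ_power_zero) auto
      then have "(\<lambda>m. F m t - K t) \<longlonglongrightarrow> 0"
        by (intro Lim_null_comparison[OF always_eventually[OF allI[OF close]]]) simp
      then show ?thesis by (rule LIM_zero_cancel)
    qed
    show "\<exists>M. \<forall>m t. norm (F m t) \<le> M"
      using LIMSEQ_le_const2[OF tendsto_norm[OF lim]] T_bound by blast
  qed
qed

text \<open>The derivative of \<open>F\<^sub>m\<close> is a combination of \<open>F\<^sub>m\<close>, \<open>F\<^sub>m\<^sub>+\<^sub>1\<close> and the smooth function
  \<open>g\<^sub>m * F\<^sub>m\<^sub>+\<^sub>1\<close>. The span of all the \<open>F\<^sub>m\<close> and all smooth functions is therefore closed under
  differentiation, which is all that smoothness requires.\<close>

lemma infinite_convolution_smooth: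
  fixes F :: "nat \<Rightarrow> real \<Rightarrow> 'k::{real_normed_field, euclidean_space}"
  assumes \<theta>: "\<And>n. cutoff (d n) (\<theta> n)" "\<And>n. d n > 0"
    and F: "\<And>m. continuous_on UNIV (F m)" "\<And>m. kernel_on (a m) (b m) (F m)"
    and step: "\<And>m. F m = exp_kernel (l m) (\<theta> m) \<star> F (Suc m)"
  shows "smooth (F m)"
proof (rule smooth_generators[where B = "range F \<union> Collect smooth"])
  fix f assume "f \<in> range F \<union> Collect smooth"
  then consider m where "f = F m" | "smooth f" by blast
  then show "\<exists>f'\<in>linear_closure (range F \<union> Collect smooth). \<forall>t. (f has_vector_derivative f' t) (at t)"
  proof cases
    case 1
    let ?g = "exp_remainder (l m) (\<theta> m) :: real \<Rightarrow> 'k"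
    define f' where "f' = (\<lambda>t. l m *\<^sub>R (1 *\<^sub>R F (Suc m) t + (-1) *\<^sub>R (F (Suc m) \<star> ?g) t) + (- l m) *\<^sub>R F m t)"
    have "smooth (F (Suc m) \<star> ?g)"
      by (rule smooth_convolution(1)[OF F(2) smooth_exp_remainder[OF \<theta>(1)]])
    then have "f' \<in> linear_closure (range F \<union> Collect smooth)"
      unfolding f'_def by (intro linear_closure.intros) auto
    moreover have "(f has_vector_derivative f' t) (at t)" for t
      using exp_kernel_convolution_has_vector_derivative[OF \<theta>[of m] F(1,2)[of "Suc m"], where l = "l m" and t = t]
      unfolding f'_def 1 by (simp add: step[symmetric] convolution_commute[of ?g] algebra_simps)
    ultimately show ?thesis by blast
  next
    case 2
    then have "iter_deriv 1 f \<in> linear_closure (range F \<union> Collect smooth)"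
      by (intro linear_closure.generator) (simp add: smooth_iter_deriv)
    then show ?thesis
      using iter_deriv_has_vector_derivative[OF 2, of 0] by auto
  qed
qed simp

text \<open>The parameters are chosen one after the other: \<open>l\<^sub>n\<close> has to be large compared with \<open>\<Psi>\<^sub>n\<close> and
  \<open>G\<^sub>n\<close>, which depend on the earlier choices only. Here \<open>\<Psi>\<^sub>n = \<Prod> (1 + D/l\<^sub>i) \<Psi>\<^sub>0\<close> and
  \<open>\<delta> - G\<^sub>n = \<Prod> (\<delta> - g\<^sub>i)\<close>, with products over \<open>i < n\<close>.\<close>

lemma damping_sequence_exists:
  fixes \<Psi>0 :: "real \<Rightarrow> 'k::{real_normed_field, euclidean_space}"
  assumes \<theta>: "\<And>n. cutoff ((1/2) ^ Suc n) (\<theta> n)"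
    and \<Psi>0: "smooth \<Psi>0" "\<And>t. t \<notin> {-R..R} \<Longrightarrow> \<Psi>0 t = 0"
  obtains l \<Psi> G where
    "\<And>n. l n \<ge> 2 ^ n"
    "\<And>n t. norm (exp_remainder (l n) (\<theta> n) t :: 'k) \<le> (1/2) ^ n"
    "\<Psi> 0 = \<Psi>0" "\<And>n. \<Psi> (Suc n) = (\<lambda>t. \<Psi> n t + (1 / l n) *\<^sub>R iter_deriv (Suc 0) (\<Psi> n) t)"
    "\<And>n. smooth (\<Psi> n)" "\<And>n t. t \<notin> {-R..R} \<Longrightarrow> \<Psi> n t = 0"
    "\<And>n k t. k \<le> n \<Longrightarrow> norm (iter_deriv k (\<Psi> (Suc n)) t - iter_deriv k (\<Psi> n) t) \<le> (1/2) ^ n"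
    "G 0 = (\<lambda>t. 0)"
    "\<And>n. G (Suc n) = (\<lambda>t. G n t + (exp_remainder (l n) (\<theta> n) t - (G n \<star> exp_remainder (l n) (\<theta> n)) t))"
    "\<And>n. smooth (G n :: real \<Rightarrow> 'k)" "\<And>n t. t \<notin> {0..1} \<Longrightarrow> G n t = 0"
    "\<And>n k t. k \<le> n \<Longrightarrow> norm (iter_deriv k (G (Suc n)) t - iter_deriv k (G n) t) \<le> (1/2) ^ n"
proof -
  define g :: "nat \<Rightarrow> real \<Rightarrow> real \<Rightarrow> 'k" where "g = (\<lambda>n l. exp_remainder l (\<theta> n))"
  define I where "I = (\<lambda>n s. smooth (fst s) \<and> (\<forall>t. t \<notin> {-R..R} \<longrightarrow> fst s t = 0) \<and>
    smooth (snd s) \<and> (\<forall>t. t \<notin> {0..1 - (1/2) ^ n} \<longrightarrow> snd s t = (0 :: 'k)) \<and>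
    (n = 0 \<longrightarrow> s = (\<Psi>0, \<lambda>t. 0)))"
  define J where "J = (\<lambda>n (s :: (real \<Rightarrow> 'k) \<times> (real \<Rightarrow> 'k)) s' l. l \<ge> 2 ^ n \<and> (\<forall>t. norm (g n l t) \<le> (1/2) ^ n) \<and>
    fst s' = (\<lambda>t. fst s t + (1 / l) *\<^sub>R iter_deriv (Suc 0) (fst s) t) \<and>
    (\<forall>k\<le>n. \<forall>t. norm (iter_deriv k (fst s') t - iter_deriv k (fst s) t) \<le> (1/2) ^ n) \<and>
    snd s' = (\<lambda>t. snd s t + (g n l t - (snd s \<star> g n l) t)) \<and>
    (\<forall>k\<le>n. \<forall>t. norm (iter_deriv k (snd s') t - iter_deriv k (snd s) t) \<le> (1/2) ^ n))"
  have "\<exists>s'. I (Suc n) s' \<and> (\<exists>l. J n s s' l)" if s: "I n s" for n s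
  proof -
    define \<Psi> where "\<Psi> = fst s" define G where "G = snd s"
    have \<Psi>: "smooth \<Psi>" "\<And>t. t \<notin> {-R..R} \<Longrightarrow> \<Psi> t = 0"
      and G: "smooth G" "\<And>t. t \<notin> {0..1 - (1/2) ^ n} \<Longrightarrow> G t = 0"
      using s by (auto simp: I_def \<Psi>_def G_def)
    have half: "(1/2::real) ^ n \<ge> 0" "(1/2::real) ^ n \<le> 1" by (simp_all add: power_le_one)
    have G_ker: "kernel_on 0 (1 - (1/2) ^ n) G"
      by (rule kernel_on_continuous[OF smooth_continuous_on[OF G(1)] G(2)])
    obtain A where A: "A > 0" "\<And>t. norm (G t) \<le> A"
      using bounded_of_compact_support[of 0 "1 - (1/2) ^ n" G] G_ker unfolding kernel_on_def by metis
    obtain B where B: "B > 0" "\<And>j t. j \<le> Suc n \<Longrightarrow> norm (iter_deriv j \<Psi> t) \<le> B"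
      using test_function_derivs_bounded[OF test_functionI[OF \<Psi>]] by metis
    \<comment> \<open>The increment of \<open>G\<close> is \<open>g - G * g\<close>, which costs the factor \<open>1 + A\<close>.\<close>
    define e where "e = (1/2) ^ n / (1 + A)"
    have "e > 0" using A(1) by (simp add: e_def)
    have "eventually (\<lambda>l. (\<forall>k\<le>n. \<forall>t. norm (iter_deriv k (g n l) t) \<le> e) \<and> l \<ge> 2 ^ n \<and> l \<ge> B * 2 ^ n) at_top"
      unfolding g_def
      by (intro eventually_conj exp_remainder_derivs_small[OF \<theta>] eventually_ge_at_top \<open>e > 0\<close>) auto
    then obtain l where l: "\<And>k t. k \<le> n \<Longrightarrow> norm (iter_deriv k (g n l) t) \<le> e" "l \<ge> 2 ^ n" "l \<ge> B * 2 ^ n"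
      by (auto simp: eventually_at_top_linorder)
    have "l > 0" using l(2) by (smt (verit) zero_less_power)
    have g: "smooth (g n l)" "\<And>t. t \<notin> {0..(1/2) ^ Suc n} \<Longrightarrow> g n l t = 0"
      unfolding g_def using smooth_exp_remainder[OF \<theta>] exp_remainder_kernel_on[OF \<theta>[of n], of l]
      by (auto simp: kernel_on_def)
    have Gg: "smooth (G \<star> g n l)"
      by (rule smooth_convolution(1)[OF G_ker g(1)])
    define \<Psi>' where "\<Psi>' = (\<lambda>t. \<Psi> t + (1 / l) *\<^sub>R iter_deriv (Suc 0) \<Psi> t)"
    define G' where "G' = (\<lambda>t. G t + (g n l t - (G \<star> g n l) t))"
    have \<Psi>'_eq: "\<Psi>' = (\<lambda>t. 1 * \<Psi> t + of_real (1 / l) * iter_deriv (Suc 0) \<Psi> t)"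
      by (simp add: \<Psi>'_def scaleR_conv_of_real)
    have \<Psi>'_deriv: "iter_deriv k \<Psi>' t - iter_deriv k \<Psi> t = (1 / l) *\<^sub>R iter_deriv (Suc k) \<Psi> t" for k t
      unfolding \<Psi>'_eq iter_deriv_lincomb[OF \<Psi>(1) smooth_iter_deriv[OF \<Psi>(1)]]
        iter_deriv_iter_deriv[OF \<Psi>(1)] by (simp add: scaleR_conv_of_real)
    define \<Delta> where "\<Delta> = (\<lambda>t. 1 * g n l t + (-1) * (G \<star> g n l) t)"
    have \<Delta>: "smooth \<Delta>"
      unfolding \<Delta>_def by (rule smooth_lincomb[OF g(1) Gg])
    have G'_eq: "G' = (\<lambda>t. 1 * G t + 1 * \<Delta> t)"
      by (simp add: G'_def \<Delta>_def)
    have G'_deriv: "iter_deriv k G' t - iter_deriv k G t = iter_deriv k (g n l) t - (G \<star> iter_deriv k (g n l)) t" for k t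
      unfolding G'_eq iter_deriv_lincomb[OF G(1) \<Delta>]
      unfolding \<Delta>_def iter_deriv_lincomb[OF g(1) Gg] smooth_convolution(2)[OF G_ker g(1)] by simp
    have "I (Suc n) (\<Psi>', G')"
      unfolding I_def fst_conv snd_conv
    proof (intro conjI allI impI)
      show "smooth \<Psi>'"
        unfolding \<Psi>'_eq by (intro smooth_lincomb \<Psi> smooth_iter_deriv)
      show "smooth G'"
        unfolding G'_eq by (intro smooth_lincomb G \<Delta>)
      show "\<Psi>' t = 0" if "t \<notin> {-R..R}" for t
        using \<Psi>(2)[OF that] iter_deriv_zero_outside[OF \<Psi>(2) that, where n = "Suc 0"] by (simp add: \<Psi>'_def)
      show "G' t = 0" if t: "t \<notin> {0..1 - (1/2) ^ Suc n}" for t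
      proof -
        have "(G \<star> g n l) t = 0"
          by (rule convolution_zero_outside[where a = 0 and b = "1 - (1/2) ^ n" and c = 0 and d = "(1/2) ^ Suc n"])
            (use G(2) g(2) t in auto)
        moreover have "t \<notin> {0..1 - (1/2) ^ n}" using t half(1) unfolding atLeastAtMost_iff power_Suc by linarith
        moreover have "1 - (1/2::real) ^ Suc n \<ge> (1/2) ^ Suc n" using half(2) by simp
        then have "t \<notin> {0..(1/2) ^ Suc n}" using t by auto
        ultimately show ?thesis using G(2) g(2) by (simp add: G'_def)
      qed
    qed auto
    moreover have "J n s (\<Psi>', G') l"
      unfolding J_def fst_conv snd_conv \<Psi>_def[symmetric] G_def[symmetric]
    proof (intro conjI allI impI)
      have e_le: "e \<le> (1/2) ^ n"
        using A(1) half(1) by (simp add: e_def divide_le_eq mult_left_mono)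
      show "norm (g n l t) \<le> (1/2) ^ n" for t
        using l(1)[of 0 t] e_le by simp
      show "norm (iter_deriv k \<Psi>' t - iter_deriv k \<Psi> t) \<le> (1/2) ^ n" if "k \<le> n" for k t
      proof -
        have "norm (iter_deriv k \<Psi>' t - iter_deriv k \<Psi> t) \<le> B / l"
          unfolding \<Psi>'_deriv using B(2)[of "Suc k" t] that \<open>l > 0\<close> by (simp add: divide_right_mono)
        also have "\<dots> \<le> (1/2) ^ n"
          using l(3) \<open>l > 0\<close> by (simp add: field_simps power_one_over)
        finally show ?thesis .
      qed
      show "norm (iter_deriv k G' t - iter_deriv k G t) \<le> (1/2) ^ n" if "k \<le> n" for k t
      proof -
        have "norm ((G \<star> iter_deriv k (g n l)) t) \<le> (1 - (1/2) ^ n - 0) * A * e"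
          using half by (intro norm_convolution_le_sup G_ker smooth_iter_deriv_continuous_on g A l that) auto
        also have "\<dots> \<le> A * e"
          using half A(1) \<open>e > 0\<close> by (intro mult_right_mono mult_left_le_one_le) auto
        finally have "norm (iter_deriv k G' t - iter_deriv k G t) \<le> e + A * e"
          unfolding G'_deriv
          using l(1)[OF that, of t] norm_triangle_ineq4[of "iter_deriv k (g n l) t" "(G \<star> iter_deriv k (g n l)) t"]
          by linarith
        also have "\<dots> = (1 + A) * e" by (simp add: distrib_right)
        also have "\<dots> = (1/2) ^ n" using A(1) by (simp add: e_def)
        finally show ?thesis .
      qed
    qed (simp_all add: l \<Psi>'_def G'_def)
    ultimately show ?thesis by blast
  qed
  moreover have "I 0 (\<Psi>0, \<lambda>t. 0)"
    using \<Psi>0 by (simp add: I_def smooth_const)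
  ultimately obtain S where S: "\<And>n. I n (S n)" "\<And>n. \<exists>l. J n (S n) (S (Suc n)) l"
    using dependent_nat_choice[of I "\<lambda>n s s'. \<exists>l. J n s s' l"] by metis
  then obtain l where l: "\<And>n. J n (S n) (S (Suc n)) (l n)" by metis
  show ?thesis
  proof (rule that[of l "\<lambda>n. fst (S n)" "\<lambda>n. snd (S n)"])
    show "snd (S n) t = 0" if "t \<notin> {0..1}" for n t
    proof -
      have "t \<notin> {0..1 - (1/2) ^ n}" using that zero_le_power[of "1/2 :: real" n] unfolding atLeastAtMost_iff by linarith
      then show ?thesis using S(1)[of n] by (simp add: I_def)
    qed
    show "fst (S 0) = \<Psi>0" "snd (S 0) = (\<lambda>t. 0)"
      using S(1)[of 0] by (simp_all add: I_def)
    show "smooth (fst (S n))" "smooth (snd (S n))" for n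
      using S(1)[of n] by (simp_all add: I_def)
    show "fst (S n) t = 0" if "t \<notin> {-R..R}" for n t
      using S(1)[of n] that by (simp add: I_def)
    show "l n \<ge> 2 ^ n" "norm (exp_remainder (l n) (\<theta> n) t :: 'k) \<le> (1/2) ^ n"
      "fst (S (Suc n)) = (\<lambda>t. fst (S n) t + (1 / l n) *\<^sub>R iter_deriv (Suc 0) (fst (S n)) t)"
      "snd (S (Suc n)) = (\<lambda>t. snd (S n) t + (exp_remainder (l n) (\<theta> n) t - (snd (S n) \<star> exp_remainder (l n) (\<theta> n)) t))" for n t
      using l[of n] by (simp_all add: J_def g_def)
    show "norm (iter_deriv k (fst (S (Suc n))) t - iter_deriv k (fst (S n)) t) \<le> (1/2) ^ n"
      "norm (iter_deriv k (snd (S (Suc n))) t - iter_deriv k (snd (S n)) t) \<le> (1/2) ^ n" if "k \<le> n" for n k t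
      using l[of n] that unfolding J_def by blast+
  qed
qed

text \<open>The operators \<open>1 + D/l\<^sub>i\<close> for \<open>i < n\<close> are moved from \<open>\<Psi>\<^sub>n\<close> to \<open>F\<^sub>0\<close>, where each of them
  removes the kernel \<open>k\<^sub>i\<close> and leaves the factor \<open>\<delta> - g\<^sub>i\<close>. These factors combine to \<open>\<delta> - G\<^sub>n\<close>.\<close>

lemma factorization_step:
  fixes F \<Psi> G :: "nat \<Rightarrow> real \<Rightarrow> 'k::{real_normed_field, euclidean_space}"
  assumes \<theta>: "\<And>n. cutoff (d n) (\<theta> n)" "\<And>n. d n > 0" and l: "\<And>n. l n > 0"
    and F: "\<And>m. continuous_on UNIV (F m)" "\<And>m. kernel_on a b (F m)"
    and F_step: "\<And>m. F m = exp_kernel (l m) (\<theta> m) \<star> F (Suc m)"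
    and \<Psi>: "\<And>n. smooth (\<Psi> n)" "\<And>n. kernel_on a' b' (\<Psi> n)"
    and \<Psi>_step: "\<And>n. \<Psi> (Suc n) = (\<lambda>t. \<Psi> n t + (1 / l n) *\<^sub>R iter_deriv (Suc 0) (\<Psi> n) t)"
    and G: "\<And>n. smooth (G n)" "\<And>n. kernel_on 0 1 (G n)" "G 0 = (\<lambda>t. 0)"
    and G_step: "\<And>n. G (Suc n) = (\<lambda>t. G n t + (exp_remainder (l n) (\<theta> n) t - (G n \<star> exp_remainder (l n) (\<theta> n)) t))"
  shows "F 0 \<star> \<Psi> n = (\<lambda>t. (F n \<star> \<Psi> 0) t - (G n \<star> (F n \<star> \<Psi> 0)) t)"
proof (induction n)
  case 0
  show ?case by (simp add: G(3) convolution_zero_left)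
next
  case (Suc n)
  define g :: "real \<Rightarrow> 'k" where "g = exp_remainder (l n) (\<theta> n)"
  define P where "P = (\<lambda>n. F n \<star> \<Psi> 0)"
  \<comment> \<open>\<open>Q = (1 + D/l\<^sub>n) P\<^sub>n\<close>, and \<open>D\<close> is the derivative of \<open>P\<^sub>n\<close>.\<close>
  define Q where "Q = (\<lambda>t. P (Suc n) t - (g \<star> P (Suc n)) t)"
  define D where "D = (\<lambda>t. l n *\<^sub>R (Q t - P n t))"
  have P_eq: "F n \<star> \<Psi> 0 = P n" for n by (simp add: P_def)
  have \<Psi>_cont: "continuous_on UNIV (\<Psi> n)" for n by (rule smooth_continuous_on[OF \<Psi>(1)])
  have P_cont: "continuous_on UNIV (P n)" for n
    unfolding P_def by (rule convolution_continuous[OF F(2) \<Psi>_cont])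
  have P_ker: "kernel_on (a + a') (b + b') (P n)" for n
    unfolding P_def by (rule convolution_kernel_on[OF F(2) \<Psi>_cont]) (use \<Psi>(2) in \<open>auto simp: kernel_on_def\<close>)
  have g: "smooth g" "kernel_on 0 (d n) g"
    unfolding g_def by (rule smooth_exp_remainder[OF \<theta>(1)]) (rule exp_remainder_kernel_on[OF \<theta>])
  have g_cont: "continuous_on UNIV g" by (rule smooth_continuous_on[OF g(1)])
  have G_cont: "continuous_on UNIV (G n)" by (rule smooth_continuous_on[OF G(1)])
  have gF_cont: "continuous_on UNIV (g \<star> F (Suc n))"
    by (rule convolution_continuous[OF g(2) F(1)])
  have gP_cont: "continuous_on UNIV (g \<star> P (Suc n))"
    by (rule convolution_continuous[OF g(2) P_cont])
  have Q_cont: "continuous_on UNIV Q"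
    unfolding Q_def by (intro continuous_on_diff P_cont gP_cont)
  have D_cont: "continuous_on UNIV D"
    unfolding D_def by (intro continuous_intros Q_cont P_cont)

  have F_deriv: "(F n has_vector_derivative l n *\<^sub>R (F (Suc n) t - (g \<star> F (Suc n)) t - F n t)) (at t)" for t
    using exp_kernel_convolution_has_vector_derivative[OF \<theta>[of n] F(1,2)[of "Suc n"], where l = "l n" and t = t]
    by (simp add: F_step[symmetric] g_def)
  have "((\<Psi> 0 \<star> F n) has_vector_derivative
      (\<Psi> 0 \<star> (\<lambda>t. l n *\<^sub>R (F (Suc n) t - (g \<star> F (Suc n)) t - F n t))) t) (at t)" for t
    by (intro convolution_has_vector_derivative[OF \<Psi>(2) F_deriv] continuous_intros F gF_cont)
  moreover have "\<Psi> 0 \<star> (\<lambda>t. l n *\<^sub>R (F (Suc n) t - (g \<star> F (Suc n)) t - F n t)) = D"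
    unfolding convolution_scaleR_right
      convolution_diff_right[OF \<Psi>(2) continuous_on_diff[OF F(1) gF_cont] F(1)]
      convolution_diff_right[OF \<Psi>(2) F(1) gF_cont]
      convolution_left_commute[OF \<Psi>(2) g(2) F(1)] convolution_commute[of "\<Psi> 0"]
    by (simp add: D_def Q_def P_def)
  ultimately have P_deriv: "(P n has_vector_derivative D t) (at t)" for t
    by (simp add: P_def convolution_commute[of "\<Psi> 0"])
  have "((F 0 \<star> \<Psi> n) has_vector_derivative (F 0 \<star> iter_deriv (Suc 0) (\<Psi> n)) t) (at t)" for t
    using convolution_has_vector_derivative[OF F(2) iter_deriv_has_vector_derivative[OF \<Psi>(1), where n = 0]
        smooth_iter_deriv_continuous_on[OF \<Psi>(1)]] by simp
  moreover have "((F 0 \<star> \<Psi> n) has_vector_derivative D t - (G n \<star> D) t) (at t)" for t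
    unfolding Suc.IH P_eq
    by (intro has_vector_derivative_diff P_deriv convolution_has_vector_derivative[OF G(2) P_deriv D_cont])
  ultimately have deriv_eq: "(F 0 \<star> iter_deriv (Suc 0) (\<Psi> n)) t = D t - (G n \<star> D) t" for t
    using vector_derivative_unique_at by blast
  have GD: "(G n \<star> D) t = l n *\<^sub>R ((G n \<star> Q) t - (G n \<star> P n) t)" for t
    unfolding D_def convolution_scaleR_right convolution_diff_right[OF G(2) Q_cont P_cont] by simp
  have "(F 0 \<star> \<Psi> (Suc n)) t = (F 0 \<star> \<Psi> n) t + (1 / l n) *\<^sub>R (F 0 \<star> iter_deriv (Suc 0) (\<Psi> n)) t" for t
    unfolding \<Psi>_step
    by (subst convolution_add_right[OF F(2) \<Psi>_cont])
      (auto intro!: continuous_intros smooth_iter_deriv_continuous_on[OF \<Psi>(1)] simp: convolution_scaleR_right)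
  also have "\<dots> t = (P n t - (G n \<star> P n) t) + (1 / l n) *\<^sub>R (D t - (G n \<star> D) t)" for t
    unfolding deriv_eq Suc.IH P_eq ..
  also have "\<dots> t = Q t - (G n \<star> Q) t" for t
    unfolding GD using l[of n] by (simp add: D_def scaleR_diff_right)
  finally have L: "(F 0 \<star> \<Psi> (Suc n)) t = Q t - (G n \<star> Q) t" for t .

  have Gg_cont: "continuous_on UNIV (G n \<star> g)"
    by (rule convolution_continuous[OF G(2) g_cont])
  have Gg_ker: "kernel_on (0 + 0) (1 + d n) (G n \<star> g)"
    by (rule convolution_kernel_on[OF G(2) g_cont]) (use g(2) in \<open>auto simp: kernel_on_def\<close>)
  have "(G (Suc n) \<star> P (Suc n)) t = (P (Suc n) \<star> (\<lambda>t. G n t + (g t - (G n \<star> g) t))) t" for t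
    by (simp only: G_step g_def convolution_commute[of "P (Suc n)"])
  also have "\<dots> t = (P (Suc n) \<star> G n) t + ((P (Suc n) \<star> g) t - (P (Suc n) \<star> (G n \<star> g)) t)" for t
    unfolding convolution_add_right[OF P_ker G_cont continuous_on_diff[OF g_cont Gg_cont]]
      convolution_diff_right[OF P_ker g_cont Gg_cont] ..
  also have "\<dots> t = (G n \<star> P (Suc n)) t + ((g \<star> P (Suc n)) t - (G n \<star> (g \<star> P (Suc n))) t)" for t
    unfolding convolution_left_commute[OF P_ker G(2) g_cont] by (simp only: convolution_commute[of "P (Suc n)"])
  finally have R: "(G (Suc n) \<star> P (Suc n)) t
      = (G n \<star> P (Suc n)) t + ((g \<star> P (Suc n)) t - (G n \<star> (g \<star> P (Suc n))) t)" for t .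
  have "(G n \<star> Q) t = (G n \<star> P (Suc n)) t - (G n \<star> (g \<star> P (Suc n))) t" for t
    unfolding Q_def convolution_diff_right[OF G(2) P_cont gP_cont] ..
  with L R show ?case
    by (simp add: P_def Q_def fun_eq_iff)
qed

text \<open>Passing to the limit in \<open>factorization_step\<close> for \<open>\<Psi>\<^sub>0 = \<phi>'''\<close>, where \<open>F\<^sub>n\<close> tends to \<open>K\<close>, gives
  \<open>F\<^sub>0 * \<Phi> = (\<delta> - \<Gamma>) * K * \<phi>'''\<close>, and \<open>K * \<phi>''' = \<phi> - g * \<phi>\<close>. What remains is a test function convolved
  with \<open>\<phi>\<close> itself.\<close>

theorem test_function_factorization:
  fixes \<phi> :: "real \<Rightarrow> 'k::{real_normed_field, euclidean_space}"
  assumes "\<phi> \<in> test_functions"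
  obtains f1 g1 f2 g2 where "f1 \<in> test_functions" "g1 \<in> test_functions" "f2 \<in> test_functions"
    "g2 \<in> test_functions" "\<phi> = (\<lambda>t. (f1 \<star> g1) t + (f2 \<star> g2) t)"
proof -
  have \<phi>: "smooth \<phi>" by (rule test_function_smooth[OF assms])
  obtain R where R: "\<And>t. t \<notin> {-R..R} \<Longrightarrow> \<phi> t = 0"
    using test_function_supportE[OF assms] by metis
  have \<phi>_ker: "kernel_on (-R) R \<phi>"
    by (rule kernel_on_continuous[OF smooth_continuous_on[OF \<phi>] R])
  have \<phi>3: "iter_deriv 3 \<phi> t = 0" if "t \<notin> {-R..R}" for t
    by (rule iter_deriv_zero_outside[OF R that])
  obtain K K' g :: "real \<Rightarrow> 'k" where K: "\<And>t. (K has_vector_derivative K' t) (at t)" "continuous_on UNIV K'"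
    "\<And>t. t \<notin> {0..1} \<Longrightarrow> K t = 0" "\<And>t. t \<notin> {0..1} \<Longrightarrow> K' t = 0"
    and g: "smooth g" "\<And>t. t \<notin> {0..1} \<Longrightarrow> g t = 0"
    and K\<phi>: "\<And>\<phi>. smooth \<phi> \<Longrightarrow> K \<star> iter_deriv 3 \<phi> = (\<lambda>t. \<phi> t - (g \<star> \<phi>) t)"
    by (rule quadratic_kernel_exists[where ?'k = 'k]) (rule that, assumption+)
  have "\<exists>\<theta>. cutoff ((1/2) ^ Suc n) \<theta>" for n
    using cutoff_exists[of "(1/2) ^ Suc n"] by auto
  then obtain \<theta> where \<theta>: "\<And>n. cutoff ((1/2) ^ Suc n) (\<theta> n)" by metis
  obtain l \<Psi> G where l: "\<And>n. l n \<ge> 2 ^ n"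
    and small: "\<And>n t. norm (exp_remainder (l n) (\<theta> n) t :: 'k) \<le> (1/2) ^ n"
    and \<Psi>: "\<Psi> 0 = iter_deriv 3 \<phi>" "\<And>n. \<Psi> (Suc n) = (\<lambda>t. \<Psi> n t + (1 / l n) *\<^sub>R iter_deriv (Suc 0) (\<Psi> n) t)"
      "\<And>n. smooth (\<Psi> n)" "\<And>n t. t \<notin> {-R..R} \<Longrightarrow> \<Psi> n t = 0"
      "\<And>n k t. k \<le> n \<Longrightarrow> norm (iter_deriv k (\<Psi> (Suc n)) t - iter_deriv k (\<Psi> n) t) \<le> (1/2) ^ n"
    and G: "G 0 = (\<lambda>t. 0)"
      "\<And>n. G (Suc n) = (\<lambda>t. G n t + (exp_remainder (l n) (\<theta> n) t - (G n \<star> exp_remainder (l n) (\<theta> n)) t))"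
      "\<And>n. smooth (G n :: real \<Rightarrow> 'k)" "\<And>n t. t \<notin> {0..1} \<Longrightarrow> G n t = 0"
      "\<And>n k t. k \<le> n \<Longrightarrow> norm (iter_deriv k (G (Suc n)) t - iter_deriv k (G n) t) \<le> (1/2) ^ n"
    by (rule damping_sequence_exists[where R = R, OF \<theta> smooth_iter_deriv[OF \<phi>, of 3] \<phi>3])
      (assumption, rule that, assumption+)
  obtain F where F: "\<And>m. continuous_on UNIV (F m)" "\<And>m t. t \<notin> {0..1 + (1/2) ^ m} \<Longrightarrow> F m t = 0"
    "\<And>m. F m = exp_kernel (l m) (\<theta> m) \<star> F (Suc m)" "\<And>t. (\<lambda>m. F m t) \<longlonglongrightarrow> K t"
    and F_bdd: "\<exists>M. \<forall>m t. norm (F m t) \<le> M"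
    by (rule infinite_convolution_exists[OF \<theta> l small K]) (assumption, assumption, rule that, assumption+)
  obtain M where M: "\<And>m t. norm (F m t) \<le> M" using F_bdd by blast
  have l_pos: "l n > 0" for n using l[of n] by (smt (verit) zero_less_power)
  have F_ker: "kernel_on 0 2 (F m)" for m
  proof (rule kernel_on_continuous[OF F(1) F(2)])
    fix s :: real assume "s \<notin> {0..2}"
    moreover have "(1/2::real) ^ m \<le> 1" by (simp add: power_le_one)
    ultimately show "s \<notin> {0..1 + (1/2) ^ m}" by auto
  qed
  have F_smooth: "smooth (F 0)"
    by (rule infinite_convolution_smooth[where d = "\<lambda>n. (1/2) ^ Suc n"]; (rule \<theta> F F_ker)?) simp
  have \<Psi>_ker: "kernel_on (-R) R (\<Psi> n)" for n
    by (rule kernel_on_continuous[OF smooth_continuous_on[OF \<Psi>(3)] \<Psi>(4)])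
  have G_ker: "kernel_on 0 1 (G n)" for n
    by (rule kernel_on_continuous[OF smooth_continuous_on[OF G(3)] G(4)])
  have eq: "F 0 \<star> \<Psi> n = (\<lambda>t. (F n \<star> \<Psi> 0) t - (G n \<star> (F n \<star> \<Psi> 0)) t)" for n
    by (rule factorization_step[where d = "\<lambda>n. (1/2) ^ Suc n"];
        (rule \<theta> l_pos F F_ker \<Psi> \<Psi>_ker G G_ker)?) simp

  obtain \<Phi> where \<Phi>: "smooth \<Phi>" "uniform_limit UNIV \<Psi> \<Phi> sequentially"
    by (rule smooth_uniform_limit[of \<Psi> 1]) (use \<Psi>(3,5) in auto)
  obtain \<Gamma> where \<Gamma>: "smooth \<Gamma>" "uniform_limit UNIV G \<Gamma> sequentially"
    by (rule smooth_uniform_limit[of G 1]) (use G(3,5) in auto)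
  have \<Psi>_lim: "(\<lambda>n. \<Psi> n t) \<longlonglongrightarrow> \<Phi> t" for t
    using tendsto_uniform_limitI[OF \<Phi>(2)] by simp
  have G_lim: "(\<lambda>n. G n t) \<longlonglongrightarrow> \<Gamma> t" for t
    using tendsto_uniform_limitI[OF \<Gamma>(2)] by simp
  have \<Phi>_zero: "\<Phi> t = 0" if "t \<notin> {-R..R}" for t
    using LIMSEQ_unique[OF \<Psi>_lim[of t]] \<Psi>(4)[OF that] by simp
  have \<Gamma>_zero: "\<Gamma> t = 0" if "t \<notin> {0..1}" for t
    using LIMSEQ_unique[OF G_lim[of t]] G(4)[OF that] by simp
  obtain M0 where M0: "M0 > 0" "\<And>t. norm (\<Psi> 0 t) \<le> M0"
    using bounded_of_compact_support[of "-R" R "\<Psi> 0"] \<Psi>_ker unfolding kernel_on_def by metis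
  have \<Psi>_bound: "norm (\<Psi> n t) \<le> 2 + M0" for n t
  proof -
    have "norm (\<Psi> n t - \<Psi> 0 t) \<le> 2 * 1"
      by (rule norm_diff_le_geometric) (use \<Psi>(5)[of 0] in auto)
    then show ?thesis
      using norm_triangle_ineq[of "\<Psi> n t - \<Psi> 0 t" "\<Psi> 0 t"] M0(2)[of t] by simp
  qed
  have G_bound: "norm (G n t) \<le> 2" for n t
  proof -
    have "norm (G n t - G 0 t) \<le> 2 * 1"
      by (rule norm_diff_le_geometric) (use G(5)[of 0] in auto)
    then show ?thesis by (simp add: G(1))
  qed

  have \<Psi>_cont: "continuous_on UNIV (\<Psi> n)" for n by (rule smooth_continuous_on[OF \<Psi>(3)])
  have lim1: "(\<lambda>n. (F 0 \<star> \<Psi> n) t) \<longlonglongrightarrow> (F 0 \<star> \<Phi>) t" for t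
    by (rule convolution_tendsto[OF F_ker M \<Psi>_cont \<Psi>_bound tendsto_const \<Psi>_lim])
  have lim2: "(\<lambda>n. (F n \<star> \<Psi> 0) t) \<longlonglongrightarrow> (K \<star> \<Psi> 0) t" for t
    by (rule convolution_tendsto[OF F_ker M \<Psi>_cont \<Psi>_bound F(4) tendsto_const])
  have bound: "norm ((F n \<star> \<Psi> 0) t) \<le> (2 - 0) * M * M0" for n t
    by (rule norm_convolution_le_sup[OF F_ker \<Psi>_cont _ M M0(2)]) simp
  have lim3: "(\<lambda>n. (G n \<star> (F n \<star> \<Psi> 0)) t) \<longlonglongrightarrow> (\<Gamma> \<star> (K \<star> \<Psi> 0)) t" for t
    by (rule convolution_tendsto[OF G_ker G_bound convolution_continuous[OF F_ker \<Psi>_cont] bound G_lim lim2])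
  have limit: "(F 0 \<star> \<Phi>) t = (K \<star> \<Psi> 0) t - (\<Gamma> \<star> (K \<star> \<Psi> 0)) t" for t
    using lim1[of t] unfolding eq
    by (rule LIMSEQ_unique) (intro tendsto_diff lim2 lim3)

  have cont: "continuous_on UNIV \<phi>" "continuous_on UNIV g" "continuous_on UNIV \<Gamma>"
    using \<phi> g(1) \<Gamma>(1) by (auto intro: smooth_continuous_on)
  have g_ker: "kernel_on 0 1 g" and \<Gamma>_ker: "kernel_on 0 1 \<Gamma>"
    using cont g(2) \<Gamma>_zero by (auto intro!: kernel_on_continuous)
  have Gg_smooth: "smooth (\<Gamma> \<star> g)"
    by (rule smooth_convolution(1)[OF \<Gamma>_ker g(1)])
  have Gg_zero: "(\<Gamma> \<star> g) t = 0" if "t \<notin> {0..2}" for t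
    by (rule convolution_zero_outside[OF \<Gamma>_zero g(2)]) (use that in auto)
  define H where "H = (\<lambda>t. 1 * (1 * g t + 1 * \<Gamma> t) + (-1) * (\<Gamma> \<star> g) t)"
  have "smooth H"
    unfolding H_def by (intro smooth_lincomb g \<Gamma> Gg_smooth)
  then have H: "H \<in> test_functions"
  proof (rule test_functionI)
    fix t :: real assume "t \<notin> {0..2}"
    moreover from this have "t \<notin> {0..1}" by auto
    ultimately show "H t = 0" using g(2)[of t] \<Gamma>_zero[of t] Gg_zero[of t] by (simp add: H_def)
  qed
  have "\<phi> t = (F 0 \<star> \<Phi>) t + (H \<star> \<phi>) t" for t
  proof -
    have gc: "continuous_on UNIV (g \<star> \<phi>)"
      by (rule convolution_continuous[OF g_ker cont(1)])
    have "(H \<star> \<phi>) t = (\<phi> \<star> (\<lambda>t. g t + \<Gamma> t - (\<Gamma> \<star> g) t)) t"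
      by (simp add: H_def convolution_commute[of \<phi>])
    also have "\<dots> = (\<phi> \<star> g) t + (\<phi> \<star> \<Gamma>) t - (\<phi> \<star> (\<Gamma> \<star> g)) t"
      unfolding convolution_diff_right[OF \<phi>_ker continuous_on_add[OF cont(2,3)] smooth_continuous_on[OF Gg_smooth]]
        convolution_add_right[OF \<phi>_ker cont(2,3)] ..
    also have "\<dots> = (g \<star> \<phi>) t + (\<Gamma> \<star> \<phi>) t - (\<Gamma> \<star> (g \<star> \<phi>)) t"
      unfolding convolution_left_commute[OF \<phi>_ker \<Gamma>_ker cont(2)] by (simp only: convolution_commute[of \<phi>])
    finally have "(H \<star> \<phi>) t = (g \<star> \<phi>) t + (\<Gamma> \<star> \<phi>) t - (\<Gamma> \<star> (g \<star> \<phi>)) t" .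
    moreover have "(F 0 \<star> \<Phi>) t = \<phi> t - (g \<star> \<phi>) t - ((\<Gamma> \<star> \<phi>) t - (\<Gamma> \<star> (g \<star> \<phi>)) t)"
      unfolding limit \<Psi>(1) K\<phi>[OF \<phi>] convolution_diff_right[OF \<Gamma>_ker cont(1) gc] ..
    ultimately show ?thesis by simp
  qed
  moreover have "F 0 \<in> test_functions"
    by (rule test_functionI[OF F_smooth F(2)])
  moreover have "\<Phi> \<in> test_functions"
    by (rule test_functionI[OF \<Phi>(1) \<Phi>_zero])
  ultimately show ?thesis
    using that[OF _ _ H assms] by blast
qed

section \<open>Distributions and convolution\<close>

lemma bounded_bilinear_smul:
  assumes "banach_over smul"
  shows "bounded_bilinear smul"
proof -
  interpret banach_over smul by (rule assms)
  show ?thesis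
  proof
    show "smul (a + a') b = smul a b + smul a' b" for a a' b by (rule scale_left_distrib)
    show "smul a (b + b') = smul a b + smul a b'" for a b b' by (rule scale_right_distrib)
    show "smul (r *\<^sub>R a) b = r *\<^sub>R smul a b" for r a b
      by (simp add: scaleR_conv_of_real scale_scale[symmetric] smul_of_real del: scale_scale)
    show "smul a (r *\<^sub>R b) = r *\<^sub>R smul a b" for a r b
      by (simp add: smul_of_real[symmetric] mult.commute)
    show "\<exists>K. \<forall>a b. norm (smul a b) \<le> norm a * norm b * K"
      by (intro exI[of _ 1]) (simp add: norm_smul)
  qed
qed

lemma distribution_add_fun:
  "T \<in> distributions smul \<Longrightarrow> \<phi> \<in> test_functions \<Longrightarrow> \<psi> \<in> test_functions \<Longrightarrow>
    T (\<lambda>t. \<phi> t + \<psi> t) = T \<phi> + T \<psi>"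
  by (simp add: distributions_def)

lemma distribution_scale:
  "T \<in> distributions smul \<Longrightarrow> \<phi> \<in> test_functions \<Longrightarrow> T (\<lambda>t. c * \<phi> t) = smul c (T \<phi>)"
  by (simp add: distributions_def)

lemma test_function_scale: "\<phi> \<in> test_functions \<Longrightarrow> (\<lambda>t. c * \<phi> t) \<in> test_functions"
  using test_functions_lincomb[of \<phi> \<phi> c 0] by simp

lemma distribution_lincomb:
  assumes "T \<in> distributions smul" "\<phi> \<in> test_functions" "\<psi> \<in> test_functions"
  shows "T (\<lambda>t. a * \<phi> t + b * \<psi> t) = smul a (T \<phi>) + smul b (T \<psi>)"
  using distribution_add_fun[OF assms(1) test_function_scale[OF assms(2)] test_function_scale[OF assms(3)]]
  by (simp add: distribution_scale[OF assms(1)] assms)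

text \<open>Continuity on the space of all test functions yields the classical estimate by finitely many
  derivatives on each compact interval, with the unit ball of \<open>X\<close> as the neighbourhood.\<close>

lemma distribution_bounded:
  fixes smul :: "'k::{real_normed_field, euclidean_space} \<Rightarrow> 'x::banach \<Rightarrow> 'x"
  assumes smul: "banach_over smul" and T: "T \<in> distributions smul"
  obtains N C where "C > 0"
    "\<And>(\<phi> :: real \<Rightarrow> 'k) B. smooth \<phi> \<Longrightarrow> (\<And>t. t \<notin> {a..b} \<Longrightarrow> \<phi> t = 0) \<Longrightarrow>
      (\<And>j t. j \<le> N \<Longrightarrow> norm (iter_deriv j \<phi> t) \<le> B) \<Longrightarrow> norm (T \<phi>) \<le> C * B"
proof -
  interpret banach_over smul by (rule smul)
  have zero_test: "(\<lambda>t. 0) \<in> test_functions"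
    by (rule test_functionI[OF smooth_const, of 0 1]) simp
  have T0: "T (\<lambda>t. 0) = 0"
    using distribution_scale[OF T zero_test, of 0] by simp
  have "continuous_map test_topology euclidean T"
    using T by (simp add: distributions_def)
  then have "openin test_topology {\<phi> \<in> topspace test_topology. T \<phi> \<in> ball 0 1}"
    by (rule openin_continuous_map_preimage) simp
  moreover have "(\<lambda>t. 0) \<in> {\<phi> \<in> topspace test_topology. T \<phi> \<in> ball 0 1}"
    by (simp add: topspace_test_topology zero_test T0)
  ultimately obtain W where W: "W \<in> test_nhds0" "\<And>w. w \<in> W \<Longrightarrow> norm (T w) < 1"
    unfolding openin_test_topology by fastforce
  then obtain N e where e: "e > 0"
    "{\<phi> \<in> test_functions_in {a..b}. \<forall>j\<le>N. \<forall>t. norm (iter_deriv j \<phi> t) < e} \<subseteq> W"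
    unfolding test_nhds0_def using compact_Icc by blast
  show ?thesis
  proof (rule that[of "2 / e" N])
    show "2 / e > 0" using e(1) by simp
    fix \<phi> :: "real \<Rightarrow> 'k" and B
    assume \<phi>: "smooth \<phi>" "\<And>t. t \<notin> {a..b} \<Longrightarrow> \<phi> t = 0"
      and B: "\<And>j t. j \<le> N \<Longrightarrow> norm (iter_deriv j \<phi> t) \<le> B"
    have \<phi>_test: "\<phi> \<in> test_functions" by (rule test_functionI[OF \<phi>])
    have B0: "B \<ge> 0" using order_trans[OF norm_ge_zero B[of 0 0]] by simp
    show "norm (T \<phi>) \<le> 2 / e * B"
    proof (cases "B = 0")
      case True
      then have "\<phi> = (\<lambda>t. 0)" using B[of 0] by auto
      then show ?thesis by (simp add: T0 True)
    next
      case False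
      \<comment> \<open>Scaling by \<open>c\<close> moves \<open>\<phi>\<close> into the neighbourhood \<open>W\<close>.\<close>
      define c where "c = e / (2 * B)"
      have c: "c > 0" "c * B < e" using e(1) B0 False by (auto simp: c_def)
      define \<psi> where "\<psi> = (\<lambda>t. of_real c * \<phi> t + 0 * \<phi> t)"
      have \<psi>: "\<psi> \<in> test_functions"
        unfolding \<psi>_def by (rule test_functions_lincomb[OF \<phi>_test \<phi>_test])
      have "supp \<psi> \<subseteq> {a..b}"
        by (rule supp_subset_atLeastAtMost) (simp add: \<psi>_def \<phi>(2))
      moreover have "norm (iter_deriv j \<psi> t) < e" if "j \<le> N" for j t
      proof -
        have "norm (iter_deriv j \<psi> t) = c * norm (iter_deriv j \<phi> t)"
          unfolding \<psi>_def iter_deriv_lincomb[OF \<phi>(1) \<phi>(1)] using c(1) by (simp add: norm_mult)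
        also have "\<dots> \<le> c * B" using B[OF that] c(1) by simp
        finally show ?thesis using c(2) by simp
      qed
      ultimately have "\<psi> \<in> W"
        using e(2) \<psi> by (auto simp: test_functions_in_def)
      from W(2)[OF this] have "c * norm (T \<phi>) < 1"
        using c(1) by (simp add: \<psi>_def distribution_scale[OF T \<phi>_test] norm_smul)
      then show ?thesis
        using e(1) B0 False by (simp add: c_def field_simps)
    qed
  qed
qed

text \<open>For the converse it suffices that the supremum norm controls the functional on functions
  supported in a common interval: the preimages of balls are then absolutely convex
  neighbourhoods of 0.\<close>

lemma distributionI:
  fixes smul :: "'k::{real_normed_field, euclidean_space} \<Rightarrow> 'x::banach \<Rightarrow> 'x"
  assumes smul: "banach_over smul" and ext: "S \<in> extensional test_functions"
    and add: "\<And>\<phi> \<psi>. \<phi> \<in> test_functions \<Longrightarrow> \<psi> \<in> test_functions \<Longrightarrow> S (\<lambda>t. \<phi> t + \<psi> t) = S \<phi> + S \<psi>"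
    and scale: "\<And>c \<phi>. \<phi> \<in> test_functions \<Longrightarrow> S (\<lambda>t. c * \<phi> t) = smul c (S \<phi>)"
    and bound: "\<And>R. R > 0 \<Longrightarrow> \<exists>C. \<forall>\<phi>\<in>test_functions. \<forall>B. (\<forall>t. t \<notin> {-R..R} \<longrightarrow> \<phi> t = 0) \<longrightarrow>
      (\<forall>t. norm (\<phi> t) \<le> B) \<longrightarrow> norm (S \<phi>) \<le> C * B"
  shows "S \<in> distributions smul"
proof -
  interpret banach_over smul by (rule smul)
  have lin: "S (\<lambda>t. a * \<phi> t + b * \<psi> t) = smul a (S \<phi>) + smul b (S \<psi>)"
    if "\<phi> \<in> test_functions" "\<psi> \<in> test_functions" for a b \<phi> \<psi>
    using add[OF test_function_scale[OF that(1)] test_function_scale[OF that(2)]] scale that by simp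
  have nhd: "{\<phi> \<in> test_functions. norm (S \<phi>) < d} \<in> test_nhds0" (is "?W \<in> _") if "d > 0" for d
    unfolding test_nhds0_def
  proof (rule CollectI, intro conjI ballI allI impI)
    show "?W \<subseteq> test_functions" by auto
  next
    fix \<phi> \<psi> and a b :: 'k
    assume \<phi>: "\<phi> \<in> ?W" and \<psi>: "\<psi> \<in> ?W" and ab: "norm a + norm b \<le> 1"
    define m where "m = max (norm (S \<phi>)) (norm (S \<psi>))"
    have m: "0 \<le> m" "m < d" "norm (S \<phi>) \<le> m" "norm (S \<psi>) \<le> m"
      using \<phi> \<psi> by (auto simp: m_def le_max_iff_disj)
    have "norm (S (\<lambda>t. a * \<phi> t + b * \<psi> t)) \<le> norm a * norm (S \<phi>) + norm b * norm (S \<psi>)"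
      using \<phi> \<psi> norm_triangle_ineq[of "smul a (S \<phi>)" "smul b (S \<psi>)"] by (simp add: lin norm_smul)
    also have "\<dots> \<le> norm a * m + norm b * m"
      using m by (intro add_mono mult_left_mono) auto
    also have "\<dots> \<le> 1 * m"
      unfolding distrib_right[symmetric] using ab m(1) by (rule mult_right_mono)
    finally show "(\<lambda>t. a * \<phi> t + b * \<psi> t) \<in> ?W"
      using \<phi> \<psi> m(2) test_functions_lincomb by auto
  next
    fix K :: "real set" assume "compact K"
    then obtain R where R: "R > 0" "\<And>t. t \<in> K \<Longrightarrow> norm t \<le> R"
      using compact_imp_bounded[of K] by (auto simp: bounded_pos)
    obtain C where C: "\<And>\<phi> B. \<phi> \<in> test_functions \<Longrightarrow> (\<And>t. t \<notin> {-R..R} \<Longrightarrow> \<phi> t = 0) \<Longrightarrow>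
        (\<And>t. norm (\<phi> t) \<le> B) \<Longrightarrow> norm (S \<phi>) \<le> C * B"
      using bound[OF R(1)] by metis
    define e where "e = d / (1 + \<bar>C\<bar>)"
    have "e > 0" using that by (simp add: e_def)
    have "{\<phi> \<in> test_functions_in K. \<forall>j\<le>0. \<forall>t. norm (iter_deriv j \<phi> t) < e} \<subseteq> ?W"
    proof
      fix \<phi> :: "real \<Rightarrow> 'k"
      assume "\<phi> \<in> {\<phi> \<in> test_functions_in K. \<forall>j\<le>0. \<forall>t. norm (iter_deriv j \<phi> t) < e}"
      then have \<phi>: "\<phi> \<in> test_functions" "supp \<phi> \<subseteq> K" "\<And>t. norm (\<phi> t) < e"
        by (auto simp: test_functions_in_def)
      have "norm (S \<phi>) \<le> C * e"
      proof (rule C[OF \<phi>(1)])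
        fix t assume "t \<notin> {-R..R}"
        then have "t \<notin> K" using R(2)[of t] by auto
        then show "\<phi> t = 0" using \<phi>(2) zero_outside_supp by blast
      qed (rule less_imp_le[OF \<phi>(3)])
      also have "\<dots> \<le> \<bar>C\<bar> * e" using \<open>e > 0\<close> by (intro mult_right_mono) auto
      also have "\<dots> < (1 + \<bar>C\<bar>) * e" using \<open>e > 0\<close> by (simp add: distrib_right)
      also have "\<dots> = d" by (simp add: e_def)
      finally show "\<phi> \<in> ?W" using \<phi>(1) by simp
    qed
    with \<open>e > 0\<close> show "\<exists>N. \<exists>e>0. {\<phi> \<in> test_functions_in K. \<forall>j\<le>N. \<forall>t. norm (iter_deriv j \<phi> t) < e} \<subseteq> ?W"
      by blast
  qed
  \<comment> \<open>By translation invariance of the topology it suffices to use the neighbourhoods of 0.\<close>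
  have "continuous_map test_topology euclidean S"
    unfolding continuous_map_def
  proof (intro conjI allI impI)
    fix O' :: "'x set" assume "openin euclidean O'"
    then have O': "open O'" by simp
    show "openin test_topology {\<phi> \<in> topspace test_topology. S \<phi> \<in> O'}"
      unfolding openin_test_topology topspace_test_topology
    proof (intro conjI ballI)
      fix \<phi> assume "\<phi> \<in> {\<phi> \<in> test_functions. S \<phi> \<in> O'}"
      then have \<phi>: "\<phi> \<in> test_functions" "S \<phi> \<in> O'" by auto
      then obtain d where d: "d > 0" "ball (S \<phi>) d \<subseteq> O'"
        using O' open_contains_ball by blast
      have "(\<lambda>t. \<phi> t + w t) \<in> {\<phi> \<in> test_functions. S \<phi> \<in> O'}" if "w \<in> {\<phi> \<in> test_functions. norm (S \<phi>) < d}" for w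
      proof -
        have "S (\<lambda>t. \<phi> t + w t) \<in> ball (S \<phi>) d"
          using that by (simp add: add[OF \<phi>(1)] dist_norm)
        moreover have "(\<lambda>t. \<phi> t + w t) \<in> test_functions"
          using test_functions_lincomb[OF \<phi>(1), of w 1 1] that by simp
        ultimately show ?thesis using d(2) by auto
      qed
      then show "\<exists>W\<in>test_nhds0. \<forall>w\<in>W. (\<lambda>t. \<phi> t + w t) \<in> {\<phi> \<in> test_functions. S \<phi> \<in> O'}"
        using nhd[OF d(1)] by blast
    qed auto
  qed simp
  then show ?thesis
    using ext add scale by (simp add: distributions_def)
qed

lemma distribution_of_integrable:
  assumes smul: "banach_over smul" and f: "continuous_on UNIV f" and \<phi>: "\<phi> \<in> test_functions"
  shows "(\<lambda>t. smul (\<phi> t) (f t)) integrable_on UNIV"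
proof -
  interpret smul: bounded_bilinear smul by (rule bounded_bilinear_smul[OF smul])
  obtain R where R: "\<And>t. t \<notin> {-R..R} \<Longrightarrow> \<phi> t = 0"
    using test_function_supportE[OF \<phi>] by metis
  have "(\<lambda>t. smul (\<phi> t) (f t)) integrable_on {-R..R}"
    by (intro integrable_continuous_real smul.continuous_on continuous_on_subset[OF f]
        smooth_continuous_on test_function_smooth \<phi>) auto
  then show ?thesis
    by (rule integrable_on_superset) (auto simp: R smul.zero_left)
qed

lemma distribution_of_in_distributions:
  assumes smul: "banach_over smul" and f: "continuous_on UNIV f"
  shows "distribution_of smul f \<in> distributions smul"
proof (rule distributionI[OF smul])
  interpret banach_over smul by (rule smul)
  interpret smul: bounded_bilinear smul by (rule bounded_bilinear_smul[OF smul])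
  note int = distribution_of_integrable[OF smul f]
  show "distribution_of smul f \<in> extensional test_functions"
    by (simp add: distribution_of_def)
  show "distribution_of smul f (\<lambda>t. \<phi> t + \<psi> t) = distribution_of smul f \<phi> + distribution_of smul f \<psi>"
    if "\<phi> \<in> test_functions" "\<psi> \<in> test_functions" for \<phi> \<psi>
    using test_functions_lincomb[OF that, of 1 1] integral_add[OF int[OF that(1)] int[OF that(2)]] that
    by (simp add: distribution_of_def smul.add_left)
  show "distribution_of smul f (\<lambda>t. c * \<phi> t) = smul c (distribution_of smul f \<phi>)"
    if "\<phi> \<in> test_functions" for c \<phi>
    using test_function_scale[OF that, of c] that
      integral_linear[OF int[OF that] smul.bounded_linear_right[of c]]
    by (simp add: distribution_of_def o_def)
next
  interpret banach_over smul by (rule smul)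
  interpret smul: bounded_bilinear smul by (rule bounded_bilinear_smul[OF smul])
  fix R :: real assume "R > 0"
  have "bounded (f ` {-R..R})"
    by (intro compact_imp_bounded compact_continuous_image continuous_on_subset[OF f]) auto
  then obtain M where M: "M > 0" "\<And>t. t \<in> {-R..R} \<Longrightarrow> norm (f t) \<le> M"
    unfolding bounded_pos by blast
  have "norm (distribution_of smul f \<phi>) \<le> M * (2 * R) * B"
    if \<phi>: "\<phi> \<in> test_functions" "\<And>t. t \<notin> {-R..R} \<Longrightarrow> \<phi> t = 0" "\<And>t. norm (\<phi> t) \<le> B" for \<phi> B
  proof -
    have B: "B \<ge> 0" using order_trans[OF norm_ge_zero \<phi>(3)[of 0]] .
    have "continuous_on {-R..R} (\<lambda>t. smul (\<phi> t) (f t))"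
      by (intro smul.continuous_on continuous_on_subset[OF f]
        smooth_continuous_on test_function_smooth \<phi>) auto
    then have "((\<lambda>t. smul (\<phi> t) (f t)) has_integral integral {-R..R} (\<lambda>t. smul (\<phi> t) (f t))) {-R..R}"
      by (intro integrable_integral integrable_continuous_real)
    then have I: "((\<lambda>t. smul (\<phi> t) (f t)) has_integral integral {-R..R} (\<lambda>t. smul (\<phi> t) (f t))) UNIV"
      by (rule has_integral_on_superset) (auto simp: \<phi>(2) smul.zero_left)
    have "norm (integral {-R..R} (\<lambda>t. smul (\<phi> t) (f t))) \<le> (B * M) * (R - (-R))"
    proof (rule integral_bound)
      show "norm (smul (\<phi> t) (f t)) \<le> B * M" if "t \<in> {-R..R}" for t
        using \<phi>(3)[of t] M(2)[OF that] B by (simp add: norm_smul mult_mono)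
    qed (use \<open>R > 0\<close> \<open>continuous_on {-R..R} _\<close> in auto)
    then show ?thesis
      using integral_unique[OF I] \<phi>(1) by (simp add: distribution_of_def algebra_simps)
  qed
  then show "\<exists>C. \<forall>\<phi>\<in>test_functions. \<forall>B. (\<forall>t. t \<notin> {-R..R} \<longrightarrow> \<phi> t = 0) \<longrightarrow>
      (\<forall>t. norm (\<phi> t) \<le> B) \<longrightarrow> norm (distribution_of smul f \<phi>) \<le> C * B"
    by blast
qed

lemma test_function_reflect:
  assumes "\<phi> \<in> test_functions"
  shows "(\<lambda>t. \<phi> (x - t)) \<in> test_functions"
proof -
  obtain R where R: "\<And>t. t \<notin> {-R..R} \<Longrightarrow> \<phi> t = 0"
    using test_function_supportE[OF assms] by metis
  show ?thesis
    by (rule test_functionI[OF smooth_reflect[OF test_function_smooth[OF assms]], of "x - R" "x + R"])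
      (use R in auto)
qed

lemma lipschitz_of_bounded_derivative:
  assumes "\<And>t. (f has_vector_derivative f' t) (at t)" "\<And>t. norm (f' t) \<le> M"
  shows "norm (f x - f y) \<le> M * \<bar>x - y\<bar>"
proof -
  have "M \<ge> 0" using order_trans[OF norm_ge_zero assms(2)[of 0]] .
  have "norm (f x - f y) \<le> M * norm (x - y)"
  proof (rule differentiable_bound[of UNIV f "\<lambda>x h. h *\<^sub>R f' x"])
    show "onorm (\<lambda>h. h *\<^sub>R f' x) \<le> M" for x
      using assms(2)[of x] \<open>M \<ge> 0\<close> by (intro onorm_bound) (auto simp: mult.commute[of _ "norm (f' x)"] intro: mult_right_mono)
  qed (use assms(1) in \<open>auto simp: has_vector_derivative_def\<close>)
  then show ?thesis by simp
qed

lemma distribution_conv_continuous: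
  assumes smul: "banach_over smul" and T: "T \<in> distributions smul" and \<phi>: "\<phi> \<in> test_functions"
  shows "continuous_on UNIV (distribution_conv T \<phi>)"
proof -
  interpret banach_over smul by (rule smul)
  obtain R where R: "\<And>t. t \<notin> {-R..R} \<Longrightarrow> \<phi> t = 0"
    using test_function_supportE[OF \<phi>] by metis
  have \<phi>_smooth: "smooth \<phi>" by (rule test_function_smooth[OF \<phi>])
  have "isCont (distribution_conv T \<phi>) x" for x
  proof -
    obtain N C where C: "C > 0"
      "\<And>\<phi> B. smooth \<phi> \<Longrightarrow> (\<And>t. t \<notin> {x - 1 - R..x + 1 + R} \<Longrightarrow> \<phi> t = 0) \<Longrightarrow>
        (\<And>j t. j \<le> N \<Longrightarrow> norm (iter_deriv j \<phi> t) \<le> B) \<Longrightarrow> norm (T \<phi>) \<le> C * B"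
      using distribution_bounded[OF smul T] by metis
    obtain M where M: "M > 0" "\<And>j t. j \<le> Suc N \<Longrightarrow> norm (iter_deriv j \<phi> t) \<le> M"
      using test_function_derivs_bounded[OF \<phi>] by metis
    have est: "norm (distribution_conv T \<phi> y - distribution_conv T \<phi> x) \<le> C * (M * \<bar>y - x\<bar>)"
      if y: "\<bar>y - x\<bar> \<le> 1" for y
    proof -
      define D where "D = (\<lambda>z. 1 * \<phi> (y - z) + (-1) * \<phi> (x - z))"
      have "distribution_conv T \<phi> y - distribution_conv T \<phi> x = T D"
        unfolding D_def distribution_lincomb[OF T test_function_reflect[OF \<phi>] test_function_reflect[OF \<phi>]]
        by (simp add: distribution_conv_def)
      also have "norm (T D) \<le> C * (M * \<bar>y - x\<bar>)"
      proof (rule C(2))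
        show "smooth D"
          unfolding D_def by (intro smooth_lincomb smooth_reflect \<phi>_smooth)
        show "D z = 0" if "z \<notin> {x - 1 - R..x + 1 + R}" for z
        proof -
          have "y - z \<notin> {-R..R}" "x - z \<notin> {-R..R}" using that y by auto
          then show ?thesis by (simp add: D_def R)
        qed
        show "norm (iter_deriv j D z) \<le> M * \<bar>y - x\<bar>" if "j \<le> N" for j z
        proof -
          have "iter_deriv j D z = (-1) ^ j *\<^sub>R (iter_deriv j \<phi> (y - z) - iter_deriv j \<phi> (x - z))"
            unfolding D_def iter_deriv_lincomb[OF smooth_reflect[OF \<phi>_smooth] smooth_reflect[OF \<phi>_smooth]]
              iter_deriv_reflect[OF \<phi>_smooth] by (simp add: scaleR_diff_right)
          then have "norm (iter_deriv j D z) = norm (iter_deriv j \<phi> (y - z) - iter_deriv j \<phi> (x - z))"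
            by (simp add: power_abs)
          also have "\<dots> \<le> M * \<bar>(y - z) - (x - z)\<bar>"
            by (rule lipschitz_of_bounded_derivative[OF iter_deriv_has_vector_derivative[OF \<phi>_smooth] M(2)])
              (use that in simp)
          finally show ?thesis by simp
        qed
      qed
      finally show ?thesis .
    qed
    have "((\<lambda>y. C * (M * \<bar>y - x\<bar>)) \<longlongrightarrow> C * (M * \<bar>x - x\<bar>)) (at x)"
      by (intro tendsto_intros)
    then have lim: "((\<lambda>y. C * (M * \<bar>y - x\<bar>)) \<longlongrightarrow> 0) (at x)" by simp
    have "\<forall>\<^sub>F y in at x. norm (distribution_conv T \<phi> y - distribution_conv T \<phi> x) \<le> C * (M * \<bar>y - x\<bar>)"
      unfolding eventually_at by (intro exI[of _ 1]) (auto simp: dist_real_def intro: est)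
    from Lim_null_comparison[OF this lim] show ?thesis
      unfolding isCont_def by (simp add: LIM_zero_iff)
  qed
  then show ?thesis by (simp add: continuous_at_imp_continuous_on)
qed

text \<open>Truncating the convolution kernel to \<open>[p, q]\<close> makes the convolution an integral over \<open>[p, q]\<close>,
  whose upper limit can be varied.\<close>

definition restrict_kernel :: "real \<Rightarrow> real \<Rightarrow> (real \<Rightarrow> 'a::zero) \<Rightarrow> real \<Rightarrow> 'a" where
  "restrict_kernel p q u s = (if s \<in> {p..q} then u s else 0)"

lemma restrict_kernel_kernel_on: "continuous_on UNIV u \<Longrightarrow> kernel_on p q (restrict_kernel p q u)"
  using continuous_on_cong[of "{p..q}" "{p..q}" "restrict_kernel p q u" u] continuous_on_subset[of UNIV u "{p..q}"]
  by (simp add: kernel_on_def restrict_kernel_def)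

lemma restrict_kernel_convolution:
  assumes "continuous_on UNIV u" "continuous_on UNIV f"
  shows "(restrict_kernel p q u \<star> f) t = integral {p..q} (\<lambda>s. u s * f (t - s))"
  unfolding convolution_eq_integral[OF restrict_kernel_kernel_on[OF assms(1)] assms(2)]
  by (intro integral_cong) (simp add: restrict_kernel_def)

text \<open>A distribution commutes with the integral that defines a convolution. Put
  \<open>J(r) = T (\<integral> u(y) \<phi>(\<cdot> - y) dy)\<close>, with the integral over \<open>[-a, r]\<close>. Its difference quotients
  converge to the integrand \<open>u(r) T(\<phi>(\<cdot> - r))\<close>, because the corresponding difference quotients of
  test functions converge uniformly with all derivatives, and the fundamental theorem of calculus
  gives the claim.\<close>

lemma distribution_convolution_has_integral:
  assumes smul: "banach_over smul" and T: "T \<in> distributions smul"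
    and u: "u \<in> test_functions" and \<phi>: "\<phi> \<in> test_functions"
  shows "((\<lambda>y. smul (u y) (T (\<lambda>z. \<phi> (z - y)))) has_integral T (u \<star> \<phi>)) UNIV"
proof -
  interpret banach_over smul by (rule smul)
  have u_smooth: "smooth u" and \<phi>_smooth: "smooth \<phi>"
    by (rule test_function_smooth[OF u], rule test_function_smooth[OF \<phi>])
  have u_cont: "continuous_on UNIV u" and \<phi>_cont: "continuous_on UNIV \<phi>"
    by (rule smooth_continuous_on[OF u_smooth], rule smooth_continuous_on[OF \<phi>_smooth])
  obtain a where "a > 0" and u_zero: "\<And>t. t \<notin> {-a..a} \<Longrightarrow> u t = 0"
    using test_function_supportE[OF u] by metis
  obtain R where R: "\<And>t. t \<notin> {-R..R} \<Longrightarrow> \<phi> t = 0"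
    using test_function_supportE[OF \<phi>] by metis
  define cut where "cut = (\<lambda>p q. restrict_kernel p q u)"
  have cut_ker: "kernel_on p q (cut p q)" for p q
    unfolding cut_def by (rule restrict_kernel_kernel_on[OF u_cont])
  have cut_zero: "(cut p q \<star> \<phi>) t = 0" if "t \<notin> {p - R..q + R}" for p q t
    by (rule convolution_zero_outside[where a = p and b = q and c = "-R" and d = R])
      (use that R in \<open>auto simp: cut_def restrict_kernel_def\<close>)
  have cut_smooth: "smooth (cut p q \<star> \<phi>)" for p q
    by (rule smooth_convolution(1)[OF cut_ker \<phi>_smooth])
  have cut_test: "cut p q \<star> \<phi> \<in> test_functions" for p q
    by (rule test_functionI[OF cut_smooth cut_zero])
  have shift_smooth: "smooth (\<lambda>z. \<phi> (z - r))" for r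
    using smooth_affine(1)[OF \<phi>_smooth, of 1 "-r"] by simp
  have shift_deriv: "iter_deriv j (\<lambda>z. \<phi> (z - r)) z = iter_deriv j \<phi> (z - r)" for j r z
    using smooth_affine(2)[OF \<phi>_smooth, of j 1 "-r"] by simp
  have shift_test: "(\<lambda>z. \<phi> (z - r)) \<in> test_functions" for r
    by (rule test_functionI[OF shift_smooth, of "r - R" "r + R"]) (use R in auto)

  obtain N C where C: "C > 0"
    "\<And>\<phi> B. smooth \<phi> \<Longrightarrow> (\<And>t. t \<notin> {-a - R..a + R} \<Longrightarrow> \<phi> t = 0) \<Longrightarrow>
      (\<And>j t. j \<le> N \<Longrightarrow> norm (iter_deriv j \<phi> t) \<le> B) \<Longrightarrow> norm (T \<phi>) \<le> C * B"
    using distribution_bounded[OF smul T] by metis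
  obtain M where M: "M > 0" "\<And>j t. j \<le> Suc N \<Longrightarrow> norm (iter_deriv j \<phi> t) \<le> M"
    using test_function_derivs_bounded[OF \<phi>] by metis
  obtain U where U: "U > 0" "\<And>j t. j \<le> Suc 0 \<Longrightarrow> norm (iter_deriv j u t) \<le> U"
    using test_function_derivs_bounded[OF u] by metis

  define w where "w = (\<lambda>y. smul (u y) (T (\<lambda>z. \<phi> (z - y))))"
  define J where "J = (\<lambda>r. T (cut (-a) r \<star> \<phi>))"
  \<comment> \<open>A quadratic error makes \<open>w r\<close> the derivative of \<open>J\<close> at \<open>r\<close>, from either side.\<close>
  have local: "norm (T (cut p q \<star> \<phi>) - (q - p) *\<^sub>R w r) \<le> C * (2 * U * M * (q - p) * (q - p))"
    if pq: "-a \<le> p" "p \<le> q" "q \<le> a" and r: "r \<in> {p..q}" for p q r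
  proof -
    define c where "c = - (of_real (q - p) * u r)"
    define D where "D = (\<lambda>z. 1 * (cut p q \<star> \<phi>) z + c * \<phi> (z - r))"
    have "T D = T (cut p q \<star> \<phi>) - (q - p) *\<^sub>R w r"
      unfolding D_def distribution_lincomb[OF T cut_test shift_test]
      by (simp add: c_def w_def smul_of_real[symmetric] del: of_real_diff)
    moreover have "norm (T D) \<le> C * (2 * U * M * (q - p) * (q - p))"
    proof (rule C(2))
      show "smooth D"
        unfolding D_def by (intro smooth_lincomb cut_smooth shift_smooth)
      show "D z = 0" if "z \<notin> {-a - R..a + R}" for z
      proof -
        have "z \<notin> {p - R..q + R}" "z - r \<notin> {-R..R}" using that pq r by auto
        then show ?thesis by (simp add: D_def R cut_zero)
      qed
      show "norm (iter_deriv j D z) \<le> 2 * U * M * (q - p) * (q - p)" if j: "j \<le> N" for j z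
      proof -
        let ?f = "\<lambda>s. u s * iter_deriv j \<phi> (z - s)"
        have f_cont: "continuous_on {p..q} ?f"
          using continuous_on_subset[OF u_cont]
          by (intro continuous_intros continuous_on_compose2[OF smooth_iter_deriv_continuous_on[OF \<phi>_smooth, of UNIV]]) auto
        have "iter_deriv j D z = (cut p q \<star> iter_deriv j \<phi>) z + c * iter_deriv j \<phi> (z - r)"
          unfolding D_def iter_deriv_lincomb[OF cut_smooth shift_smooth]
            smooth_convolution(2)[OF cut_ker \<phi>_smooth] shift_deriv by simp
        also have "\<dots> = integral {p..q} ?f - (q - p) *\<^sub>R ?f r"
          unfolding cut_def restrict_kernel_convolution[OF u_cont smooth_iter_deriv_continuous_on[OF \<phi>_smooth]]
          by (simp add: c_def scaleR_conv_of_real)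
        also have "\<dots> = integral {p..q} (\<lambda>s. ?f s - ?f r)"
          using pq(2) by (subst integral_diff) (auto intro: integrable_continuous_real f_cont)
        finally have "iter_deriv j D z = integral {p..q} (\<lambda>s. ?f s - ?f r)" .
        also have "norm \<dots> \<le> (2 * U * M * (q - p)) * (q - p)"
        proof (rule integral_bound[OF pq(2)])
          show "continuous_on {p..q} (\<lambda>s. ?f s - ?f r)"
            by (intro continuous_on_diff f_cont continuous_on_const)
          show "norm (?f s - ?f r) \<le> 2 * U * M * (q - p)" if "s \<in> {p..q}" for s
          proof -
            have sr: "\<bar>s - r\<bar> \<le> q - p" using that r by auto
            have "?f s - ?f r = (u s - u r) * iter_deriv j \<phi> (z - s)
                + u r * (iter_deriv j \<phi> (z - s) - iter_deriv j \<phi> (z - r))"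
              by (simp add: algebra_simps)
            then have "norm (?f s - ?f r) \<le> norm (u s - u r) * norm (iter_deriv j \<phi> (z - s))
                + norm (u r) * norm (iter_deriv j \<phi> (z - s) - iter_deriv j \<phi> (z - r))"
              by (metis norm_mult norm_triangle_ineq)
            also have "\<dots> \<le> (U * \<bar>s - r\<bar>) * M + U * (M * \<bar>(z - s) - (z - r)\<bar>)"
            proof (intro add_mono mult_mono)
              show "norm (u s - u r) \<le> U * \<bar>s - r\<bar>"
                using lipschitz_of_bounded_derivative[OF iter_deriv_has_vector_derivative[OF u_smooth, of 0] U(2)] by simp
              show "norm (iter_deriv j \<phi> (z - s) - iter_deriv j \<phi> (z - r)) \<le> M * \<bar>(z - s) - (z - r)\<bar>"
                by (rule lipschitz_of_bounded_derivative[OF iter_deriv_has_vector_derivative[OF \<phi>_smooth] M(2)])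
                  (use j in simp)
            qed (use U(1) U(2)[of 0] M(1) M(2)[of j] j in auto)
            also have "\<dots> = 2 * U * M * \<bar>s - r\<bar>" by (simp add: abs_minus_commute)
            also have "\<dots> \<le> 2 * U * M * (q - p)"
              using sr U(1) M(1) by (intro mult_left_mono) auto
            finally show ?thesis .
          qed
        qed
        finally show ?thesis .
      qed
    qed
    ultimately show ?thesis by simp
  qed
  have J_diff: "J q - J p = T (cut p q \<star> \<phi>)" if pq: "-a \<le> p" "p \<le> q" for p q
  proof -
    have "(cut (-a) q \<star> \<phi>) t = (cut (-a) p \<star> \<phi>) t + (cut p q \<star> \<phi>) t" for t
      unfolding cut_def restrict_kernel_convolution[OF u_cont \<phi>_cont]
      using pq by (intro Henstock_Kurzweil_Integration.integral_combine[symmetric] integrable_continuous_real continuous_intros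
          continuous_on_subset[OF u_cont] continuous_on_compose2[OF \<phi>_cont]) auto
    then have "cut (-a) q \<star> \<phi> = (\<lambda>t. (cut (-a) p \<star> \<phi>) t + (cut p q \<star> \<phi>) t)" by auto
    then show ?thesis
      unfolding J_def using distribution_add_fun[OF T cut_test cut_test] by simp
  qed
  have deriv: "(J has_vector_derivative w r) (at r within {-a..a})" if r: "r \<in> {-a..a}" for r
    unfolding has_vector_derivative_def has_derivative_iff_norm
  proof (intro conjI)
    show "bounded_linear (\<lambda>x. x *\<^sub>R w r)" by (rule bounded_linear_scaleR_left)
    have est: "norm (J y - J r - (y - r) *\<^sub>R w r) \<le> C * (2 * U * M * \<bar>y - r\<bar> * \<bar>y - r\<bar>)"
      if y: "y \<in> {-a..a}" for y
    proof (cases "r \<le> y")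
      case True
      then show ?thesis
        using local[of r y r] r y J_diff[of r y] by auto
    next
      case False
      have "J y - J r - (y - r) *\<^sub>R w r = - (T (cut y r \<star> \<phi>) - (r - y) *\<^sub>R w r)"
        using J_diff[of y r] False y by (simp add: algebra_simps)
      then show ?thesis
        using local[of y r r] r y False by (simp only: norm_minus_cancel) auto
    qed
    have "((\<lambda>y. C * (2 * U * M * \<bar>y - r\<bar>)) \<longlongrightarrow> C * (2 * U * M * \<bar>r - r\<bar>)) (at r within {-a..a})"
      by (intro tendsto_intros)
    then have lim: "((\<lambda>y. C * (2 * U * M * \<bar>y - r\<bar>)) \<longlongrightarrow> 0) (at r within {-a..a})" by simp
    have "\<forall>\<^sub>F y in at r within {-a..a}. norm (norm (J y - J r - (y - r) *\<^sub>R w r) / norm (y - r)) \<le> C * (2 * U * M * \<bar>y - r\<bar>)"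
      unfolding eventually_at
    proof (intro exI[of _ 1] conjI ballI impI)
      fix y assume y: "y \<in> {-a..a}" "y \<noteq> r \<and> dist y r < 1"
      then show "norm (norm (J y - J r - (y - r) *\<^sub>R w r) / norm (y - r)) \<le> C * (2 * U * M * \<bar>y - r\<bar>)"
        using est[OF y(1)] by (simp add: divide_le_eq mult.assoc)
    qed simp
    from Lim_null_comparison[OF this lim]
    show "((\<lambda>y. norm (J y - J r - (y - r) *\<^sub>R w r) / norm (y - r)) \<longlongrightarrow> 0) (at r within {-a..a})" .
  qed
  have "(w has_integral J a - J (-a)) {-a..a}"
    using \<open>a > 0\<close> deriv by (intro fundamental_theorem_of_calculus) auto
  moreover have "J a - J (-a) = T (u \<star> \<phi>)"
  proof -
    have "cut (-a) a = u"
      using u_zero by (auto simp: cut_def restrict_kernel_def)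
    then show ?thesis using J_diff[of "-a" a] \<open>a > 0\<close> by simp
  qed
  ultimately have "(w has_integral T (u \<star> \<phi>)) {-a..a}" by simp
  then show ?thesis
    unfolding w_def by (rule has_integral_on_superset) (auto simp: u_zero)
qed

lemma convolution_reflect:
  "(\<lambda>t. \<psi> (x - t)) \<star> (\<lambda>s. \<phi> (- s)) = (\<lambda>z. (\<phi> \<star> \<psi>) (x - z))"
proof
  fix z
  have "(\<phi> \<star> \<psi>) (x - z) = (\<psi> \<star> \<phi>) (x - z)" by (simp only: convolution_commute)
  also have "\<dots> = (\<integral>s. \<psi> (x + (-1) * s) * \<phi> ((x - z) - (x + (-1) * s)) \<partial>lborel)"
    unfolding convolution_def by (subst lborel_integral_real_affine[where c = "-1" and t = x]) auto
  also have "\<dots> = ((\<lambda>t. \<psi> (x - t)) \<star> (\<lambda>s. \<phi> (- s))) z"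
    by (simp add: convolution_def)
  finally show "((\<lambda>t. \<psi> (x - t)) \<star> (\<lambda>s. \<phi> (- s))) z = (\<phi> \<star> \<psi>) (x - z)" ..
qed

text \<open>At \<open>x\<close> the left-hand side is the integral of \<open>\<psi>(x - y) T(\<phi>(y - \<cdot>))\<close> over \<open>y\<close>, and \<open>T\<close> may be taken
  out of it.\<close>

lemma distribution_conv_conv:
  assumes smul: "banach_over smul" and T: "T \<in> distributions smul"
    and \<phi>: "\<phi> \<in> test_functions" and \<psi>: "\<psi> \<in> test_functions"
  shows "distribution_conv (distribution_of smul (distribution_conv T \<phi>)) \<psi> = distribution_conv T (\<phi> \<star> \<psi>)"
proof
  fix x
  have r: "(\<lambda>s. \<phi> (- s)) \<in> test_functions"
    using test_function_reflect[OF \<phi>, of 0] by simp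
  have "((\<lambda>y. smul (\<psi> (x - y)) (T (\<lambda>z. \<phi> (y - z)))) has_integral T (\<lambda>z. (\<phi> \<star> \<psi>) (x - z))) UNIV"
    using distribution_convolution_has_integral[OF smul T test_function_reflect[OF \<psi>, of x] r]
    by (simp add: convolution_reflect)
  then show "distribution_conv (distribution_of smul (distribution_conv T \<phi>)) \<psi> x = distribution_conv T (\<phi> \<star> \<psi>) x"
    by (simp add: distribution_conv_def distribution_of_def test_function_reflect[OF \<psi>] integral_unique)
qed

lemma distribution_of_add:
  assumes "banach_over smul" "continuous_on UNIV f" "continuous_on UNIV g"
  shows "distribution_of smul (\<lambda>t. f t + g t) = distribution_add (distribution_of smul f) (distribution_of smul g)"
proof -
  interpret bounded_bilinear smul by (rule bounded_bilinear_smul[OF assms(1)])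
  show ?thesis
    using integral_add[OF distribution_of_integrable[OF assms(1,2)] distribution_of_integrable[OF assms(1,3)]]
    by (auto simp: distribution_of_def distribution_add_def restrict_def add_right)
qed

section \<open>Regularizing twice is regularizing once\<close>

theorem theorem2p10:
  fixes smul :: "'k::{real_normed_field, euclidean_space} \<Rightarrow> 'x::banach \<Rightarrow> 'x"
    and A :: "((real \<Rightarrow> 'k) \<Rightarrow> 'x) set"
  assumes "banach_over smul"
    and "A \<subseteq> distributions smul"
    and "\<And>S T. S \<in> A \<Longrightarrow> T \<in> A \<Longrightarrow> distribution_add S T \<in> A"
  shows "distributions_rel smul (distributions_rel smul A) = distributions_rel smul A"
proof -
  note smul = assms(1)
  have conv_mem: "distribution_of smul (distribution_conv T \<phi>) \<in> distributions_rel smul A \<longleftrightarrow>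
      (\<forall>\<psi>\<in>test_functions. distribution_of smul (distribution_conv T (\<phi> \<star> \<psi>)) \<in> A)"
    if T: "T \<in> distributions smul" and \<phi>: "\<phi> \<in> test_functions" for T and \<phi> :: "real \<Rightarrow> 'k"
    using distribution_of_in_distributions[OF smul distribution_conv_continuous[OF smul T \<phi>]]
    by (simp add: distributions_rel_def distribution_conv_conv[OF smul T \<phi>])
  show ?thesis
  proof (intro equalityI subsetI)
    fix T assume T: "T \<in> distributions_rel smul A"
    then have "T \<in> distributions smul" by (simp add: distributions_rel_def)
    moreover have "distribution_of smul (distribution_conv T (\<phi> \<star> \<psi>)) \<in> A"
      if "\<phi> \<in> test_functions" "\<psi> \<in> test_functions" for \<phi> \<psi>
      using T test_function_convolution[OF that] by (simp add: distributions_rel_def)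
    ultimately show "T \<in> distributions_rel smul (distributions_rel smul A)"
      by (subst distributions_rel_def) (simp add: conv_mem)
  next
    fix T assume "T \<in> distributions_rel smul (distributions_rel smul A)"
    then have T: "T \<in> distributions smul"
      and "\<forall>\<phi>\<in>test_functions. distribution_of smul (distribution_conv T \<phi>) \<in> distributions_rel smul A"
      by (simp_all add: distributions_rel_def[of smul "distributions_rel smul A"])
    then have mem: "distribution_of smul (distribution_conv T (\<phi> \<star> \<psi>)) \<in> A"
      if "\<phi> \<in> test_functions" "\<psi> \<in> test_functions" for \<phi> \<psi>
      using that conv_mem by blast
    have "distribution_of smul (distribution_conv T \<eta>) \<in> A" if \<eta>: "\<eta> \<in> test_functions" for \<eta>
    proof -
      obtain f1 g1 f2 g2 where fg: "f1 \<in> test_functions" "g1 \<in> test_functions" "f2 \<in> test_functions"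
        "g2 \<in> test_functions" and eq: "\<eta> = (\<lambda>t. (f1 \<star> g1) t + (f2 \<star> g2) t)"
        using test_function_factorization[OF \<eta>] .
      have conv: "f1 \<star> g1 \<in> test_functions" "f2 \<star> g2 \<in> test_functions"
        using fg by (auto intro: test_function_convolution)
      have "distribution_conv T \<eta> = (\<lambda>x. distribution_conv T (f1 \<star> g1) x + distribution_conv T (f2 \<star> g2) x)"
        unfolding eq distribution_conv_def
        by (intro ext distribution_add_fun[OF T] test_function_reflect conv)
      then have "distribution_of smul (distribution_conv T \<eta>) =
          distribution_add (distribution_of smul (distribution_conv T (f1 \<star> g1)))
            (distribution_of smul (distribution_conv T (f2 \<star> g2)))"
        using distribution_of_add[OF smul distribution_conv_continuous[OF smul T conv(1)]
            distribution_conv_continuous[OF smul T conv(2)]] by simp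
      then show ?thesis
        using assms(3) mem fg by simp
    qed
    with T show "T \<in> distributions_rel smul A"
      by (simp add: distributions_rel_def)
  qed
qed

end
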